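(* Let $N\in(1,\infty)$ and let $(X,d,\mathfrak m)$ be an essentially non-branching metric measure space satisfying the measure contraction property $\mathrm{MCP}(0,N)$. Then the following two statements are equivalent: (a) There exists $x_0\in X$ such that $$\left(\int_X |\mathrm{lip}\,u|^2\,\mathrm d\mathfrak m\right)\left(\int_X d_{x_0}^2\,u^2\,\mathrm d\mathfrak m\right)\ \ge\ \frac{N^2}{4}\left(\int_X u^2\,\mathrm d\mathfrak m\right)^2\qquad\text{for all } u\in \mathrm{Lip}_c(X,d),$$ and the constant $\frac{N^2}{4}$ is sharp in this inequality (for this $x_0$). (b) $(X,d,\mathfrak m)$ is a volume cone, i.e. there exists $x_0\in X$ such that $$\frac{\mathfrak m(B_R(x_0))}{\mathfrak m(B_r(x_0))}=\left(\frac{R}{r}\right)^N\qquad\text{for all } 0<r<R.$$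
   Context: Metric measure space: a triple $(X,d,\mathfrak m)$ where $(X,d)$ is a complete and separable metric space and $\mathfrak m$ is a Radon measure on $X$ with $0<\mathfrak m(U)<\infty$ for every non-empty bounded open set $U\subset X$ (in particular $\mathrm{supp}\,\mathfrak m=X$). Let $\mathrm{Geo}(X):=\{\gamma\in C([0,1],X): d(\gamma_s,\gamma_t)=|s-t|\,d(\gamma_0,\gamma_1)\ \forall s,t\in[0,1]\}$. It is assumed that $(X,d)$ is geodesic: for all $x,y\in X$ there is $\gamma\in\mathrm{Geo}(X)$ with $\gamma_0=x$, $\gamma_1=y$. Notation: $B_r(x_0):=\{x\in X: d(x_0,x)<r\}$; $d_{x_0}(x):=d(x_0,x)$; $\mathrm{Lip}_c(X,d)$ is the space of real-valued Lipschitz functions on $X$ with compact support; the local Lipschitz constant is $\mathrm{lip}\,u(x):=\limsup_{y\to x}\frac{|u(y)-u(x)|}{d(x,y)}$. A constant in such an inequality is sharp if it cannot be replaced by a larger one. Optimal transport: $\mathscr P(X)$ is the set of Borel probability measures on $X$, $\mathscr P_2(X)$ the subset of those with finite second moment, and $W_2^2(\mu_0,\mu_1):=\inf_\pi\int_{X\times X} d^2(x,y)\,\pi(\mathrm dx\,\mathrm dy)$, the infimum being over all $\pi\in\mathscr P(X\times X)$ with first marginal $\mu_0$ and second marginal $\mu_1$. Let $e_t:\mathrm{Geo}(X)\to X$, $e_t(\gamma):=\gamma_t$. $\mathrm{OptGeo}(\mu_0,\mu_1)$ is the set of all $\nu\in\mathscr P(\mathrm{Geo}(X))$ such that $(e_0,e_1)_\sharp\nu$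 has marginals $\mu_0,\mu_1$ and attains the infimum defining $W_2^2(\mu_0,\mu_1)$. Essentially non-branching: a set $G\subset\mathrm{Geo}(X)$ is a set of non-branching geodesics if for any $\gamma^1,\gamma^2\in G$: whenever there is $t\in(0,1)$ with $\gamma^1_s=\gamma^2_s$ for all $s\in[0,t]$, then $\gamma^1_s=\gamma^2_s$ for all $s\in[0,1]$. The space $(X,d,\mathfrak m)$ is essentially non-branching if for any $\mu_0,\mu_1\in\mathscr P_2(X)$ with $\mu_0,\mu_1\ll\mathfrak m$, every element of $\mathrm{OptGeo}(\mu_0,\mu_1)$ is concentrated on a set of non-branching geodesics. $\mathrm{MCP}(0,N)$: $(X,d,\mathfrak m)$ satisfies $\mathrm{MCP}(0,N)$ if for every Borel set $A\subset X$ with $\mathfrak m(A)\in(0,\infty)$ such that $\mu_0:=\frac{1}{\mathfrak m(A)}\mathfrak m\llcorner_A\in\mathscr P_2(X)$, and every $o\in X$, there exists $\nu\in\mathrm{OptGeo}(\mu_0,\delta_o)$ such that $$\frac{1}{\mathfrak m(A)}\,\mathfrak m\ \ge\ (e_t)_\sharp\big((1-t)^N\,\nu\big)\qquad\text{for all } t\in[0,1].$$ (This is the general $\mathrm{MCP}(K,N)$ condition at $K=0$, where the distortion coefficient is $\tau^{(1-t)}_{0,N}(\theta)=1-t$.) *)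

theory Defs
  imports "HOL-Probability.Probability"
begin

text \<open>
  The metric space is the universe of a type of class \<open>polish_space\<close>, whose metric is \<open>dist\<close>.
\<close>

definition radon_measure :: "'a::topological_space measure \<Rightarrow> bool" where
  "radon_measure m \<longleftrightarrow>
     sets m = sets borel \<and>
     (\<forall>x. \<exists>U. open U \<and> x \<in> U \<and> emeasure m U < \<infinity>) \<and>
     (\<forall>A\<in>sets borel. emeasure m A = (SUP K\<in>{K. K \<subseteq> A \<and> compact K}. emeasure m K))"

definition metric_measure_space :: "'a::polish_space measure \<Rightarrow> bool" where
  "metric_measure_space m \<longleftrightarrow>
     radon_measure m \<and>
     (\<forall>U. open U \<longrightarrow> bounded U \<longrightarrow> U \<noteq> {} \<longrightarrow> 0 < emeasure m U \<and> emeasure m U < \<infinity>)"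


text \<open>
  A path in \<open>C([0,1],X)\<close> is represented by its extension to the real line that is constant on
  \<open>{..0}\<close> and on \<open>{1..}\<close>. This identifies \<open>C([0,1],X)\<close>, with the uniform distance, isometrically
  with a closed subset of the library's space of bounded continuous functions; the Borel sets
  of \<open>Geo\<close> are those of the topology of uniform convergence.
\<close>

definition Geo :: "(real \<Rightarrow>\<^sub>C 'a::metric_space) set" where
  "Geo = {\<gamma> :: real \<Rightarrow>\<^sub>C 'a. (\<forall>s\<in>{0..1}. \<forall>t\<in>{0..1}. dist (\<gamma> s) (\<gamma> t) = \<bar>s - t\<bar> * dist (\<gamma> 0) (\<gamma> 1)) \<and>
           (\<forall>t. \<gamma> t = \<gamma> (max 0 (min 1 t)))}"

lemma Geo_extends_iff:
  fixes g :: "real \<Rightarrow> 'a::metric_space"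
  shows "(\<exists>\<gamma>\<in>Geo. \<forall>t\<in>{0..1}. apply_bcontfun \<gamma> t = g t) \<longleftrightarrow>
         (\<forall>s\<in>{0..1}. \<forall>t\<in>{0..1}. dist (g s) (g t) = \<bar>s - t\<bar> * dist (g 0) (g 1))"
proof
  assume "\<exists>\<gamma>\<in>Geo. \<forall>t\<in>{0..1}. apply_bcontfun \<gamma> t = g t"
  then obtain \<gamma> where "\<gamma> \<in> Geo" and eq: "\<And>t. t \<in> {0..1} \<Longrightarrow> apply_bcontfun \<gamma> t = g t"
    by blast
  from \<open>\<gamma> \<in> Geo\<close> have "\<forall>s\<in>{0..1}. \<forall>t\<in>{0..1}. dist (\<gamma> s) (\<gamma> t) = \<bar>s - t\<bar> * dist (\<gamma> 0) (\<gamma> 1)"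
    unfolding Geo_def by blast
  then show "\<forall>s\<in>{0..1}. \<forall>t\<in>{0..1}. dist (g s) (g t) = \<bar>s - t\<bar> * dist (g 0) (g 1)"
    using eq by (metis atLeastAtMost_iff order_refl zero_le_one)
next
  assume g: "\<forall>s\<in>{0..1}. \<forall>t\<in>{0..1}. dist (g s) (g t) = \<bar>s - t\<bar> * dist (g 0) (g 1)"
  define h where "h t = g (max 0 (min 1 t))" for t
  have "(dist (g 0) (g 1))-lipschitz_on UNIV h"
  proof (rule lipschitz_onI)
    fix x y :: real
    have "dist (h x) (h y) = \<bar>max 0 (min 1 x) - max 0 (min 1 y)\<bar> * dist (g 0) (g 1)"
      unfolding h_def by (rule g[rule_format]) auto
    also have "\<dots> \<le> \<bar>x - y\<bar> * dist (g 0) (g 1)"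
      by (rule mult_right_mono) auto
    finally show "dist (h x) (h y) \<le> dist (g 0) (g 1) * dist x y"
      by (simp add: dist_real_def mult.commute)
  qed simp
  then have "continuous_on UNIV h"
    by (rule lipschitz_on_continuous_on)
  moreover have "bounded (range h)"
  proof -
    have "range h \<subseteq> h ` {0..1}"
    proof safe
      fix t show "h t \<in> h ` {0..1}"
        by (rule image_eqI[of _ _ "max 0 (min 1 t)"]) (auto simp: h_def)
    qed
    moreover have "compact (h ` {0..1})"
      using \<open>continuous_on UNIV h\<close> by (meson compact_Icc compact_continuous_image continuous_on_subset top_greatest)
    ultimately show ?thesis
      using bounded_subset compact_imp_bounded by blast
  qed
  ultimately have "h \<in> bcontfun"
    by (simp add: bcontfun_def)
  then obtain \<gamma> where \<gamma>: "h = apply_bcontfun \<gamma>"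
    by (rule bcontfunE)
  have hg: "h t = g t" if "t \<in> {0..1}" for t
    using that by (simp add: h_def)
  have "h t = h (max 0 (min 1 t))" for t
    unfolding h_def by (rule arg_cong[of _ _ g]) simp
  moreover have "\<forall>s\<in>{0..1}. \<forall>t\<in>{0..1}. dist (h s) (h t) = \<bar>s - t\<bar> * dist (h 0) (h 1)"
    using g hg by (metis atLeastAtMost_iff order_refl zero_le_one)
  ultimately have "\<gamma> \<in> Geo"
    unfolding Geo_def \<gamma> by blast
  moreover have "\<forall>t\<in>{0..1}. apply_bcontfun \<gamma> t = g t"
    using hg unfolding \<gamma> by blast
  ultimately show "\<exists>\<gamma>\<in>Geo. \<forall>t\<in>{0..1}. apply_bcontfun \<gamma> t = g t"
    by blast
qed

definition geo_borel :: "(real \<Rightarrow>\<^sub>C 'a::metric_space) measure" where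
  "geo_borel = restrict_space borel Geo"

lemma measurable_evaluation:
  "(\<lambda>\<gamma>. apply_bcontfun \<gamma> t) \<in> measurable geo_borel (borel :: 'a::metric_space measure)"
proof -
  have "1-lipschitz_on UNIV (\<lambda>\<gamma> :: real \<Rightarrow>\<^sub>C 'a. apply_bcontfun \<gamma> t)"
    by (rule lipschitz_onI) (auto intro: dist_bounded)
  then show ?thesis
    unfolding geo_borel_def
    by (intro measurable_restrict_space1 borel_measurable_continuous_onI)
      (rule lipschitz_on_continuous_on)
qed

definition geodesic_space :: "'a::metric_space itself \<Rightarrow> bool" where
  "geodesic_space _ \<longleftrightarrow> (\<forall>x y :: 'a. \<exists>\<gamma>\<in>Geo. apply_bcontfun \<gamma> 0 = x \<and> apply_bcontfun \<gamma> 1 = y)"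


definition P2 :: "'a::polish_space measure set" where
  "P2 = {\<mu> \<in> space (prob_algebra borel). \<exists>x. (\<integral>\<^sup>+ y. ennreal ((dist x y)\<^sup>2) \<partial>\<mu>) < \<infinity>}"

definition couplings ::
    "'a::polish_space measure \<Rightarrow> 'a measure \<Rightarrow> ('a \<times> 'a) measure set" where
  "couplings \<mu>0 \<mu>1 =
     {\<pi> \<in> space (prob_algebra borel). distr \<pi> borel fst = \<mu>0 \<and> distr \<pi> borel snd = \<mu>1}"

definition transport_cost :: "('a::polish_space \<times> 'a) measure \<Rightarrow> ennreal" where
  "transport_cost \<pi> = (\<integral>\<^sup>+ (x, y). ennreal ((dist x y)\<^sup>2) \<partial>\<pi>)"

definition W2_squared :: "'a::polish_space measure \<Rightarrow> 'a measure \<Rightarrow> ennreal" where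
  "W2_squared \<mu>0 \<mu>1 = (INF \<pi>\<in>couplings \<mu>0 \<mu>1. transport_cost \<pi>)"

definition OptGeo ::
    "'a::polish_space measure \<Rightarrow> 'a measure \<Rightarrow> (real \<Rightarrow>\<^sub>C 'a) measure set" where
  "OptGeo \<mu>0 \<mu>1 =
     {\<nu> \<in> space (prob_algebra geo_borel).
        distr \<nu> borel (\<lambda>\<gamma>. (apply_bcontfun \<gamma> 0, apply_bcontfun \<gamma> 1)) \<in> couplings \<mu>0 \<mu>1 \<and>
        transport_cost (distr \<nu> borel (\<lambda>\<gamma>. (apply_bcontfun \<gamma> 0, apply_bcontfun \<gamma> 1)))
          = W2_squared \<mu>0 \<mu>1}"


definition nonbranching_geodesics :: "(real \<Rightarrow>\<^sub>C 'a::metric_space) set \<Rightarrow> bool" where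
  "nonbranching_geodesics G \<longleftrightarrow>
     G \<subseteq> Geo \<and>
     (\<forall>\<gamma>1\<in>G. \<forall>\<gamma>2\<in>G.
        (\<exists>t\<in>{0<..<1}. \<forall>s\<in>{0..t}. apply_bcontfun \<gamma>1 s = apply_bcontfun \<gamma>2 s) \<longrightarrow>
        (\<forall>s\<in>{0..1}. apply_bcontfun \<gamma>1 s = apply_bcontfun \<gamma>2 s))"

text \<open>
  The set \<open>G\<close> below need not be Borel: \<open>\<nu>\<close> is concentrated on \<open>G\<close> if the complement of \<open>G\<close> is
  contained in a Borel \<open>\<nu>\<close>-null set.
\<close>

definition essentially_nonbranching :: "'a::polish_space measure \<Rightarrow> bool" where
  "essentially_nonbranching m \<longleftrightarrow>
     (\<forall>\<mu>0\<in>P2. \<forall>\<mu>1\<in>P2. absolutely_continuous m \<mu>0 \<longrightarrow> absolutely_continuous m \<mu>1 \<longrightarrow>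
        (\<forall>\<nu>\<in>OptGeo \<mu>0 \<mu>1. \<exists>G. nonbranching_geodesics G \<and> (AE \<gamma> in \<nu>. \<gamma> \<in> G)))"

definition MCP0 :: "real \<Rightarrow> 'a::polish_space measure \<Rightarrow> bool" where
  "MCP0 N m \<longleftrightarrow>
     (\<forall>A\<in>sets borel. 0 < emeasure m A \<longrightarrow> emeasure m A < \<infinity> \<longrightarrow> uniform_measure m A \<in> P2 \<longrightarrow>
        (\<forall>z. \<exists>\<nu>\<in>OptGeo (uniform_measure m A) (return borel z).
           \<forall>t\<in>{0..1}. \<forall>B\<in>sets borel.
             emeasure (distr (scale_measure (ennreal ((1 - t) powr N)) \<nu>) borel
                         (\<lambda>\<gamma>. apply_bcontfun \<gamma> t)) B
             \<le> emeasure (scale_measure (1 / emeasure m A) m) B))"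


definition Lip_c :: "('a::metric_space \<Rightarrow> real) set" where
  "Lip_c = {u. (\<exists>L. L-lipschitz_on UNIV u) \<and> compact (closure {x. u x \<noteq> 0})}"

text \<open>At an isolated point the upper limit is taken along the trivial filter, so its value is 0.\<close>

definition local_lip :: "('a::metric_space \<Rightarrow> real) \<Rightarrow> 'a \<Rightarrow> ennreal" where
  "local_lip u x = Limsup (at x) (\<lambda>y. ennreal (\<bar>u y - u x\<bar> / dist x y))"

definition uncertainty_inequality :: "'a::metric_space measure \<Rightarrow> 'a \<Rightarrow> real \<Rightarrow> bool" where
  "uncertainty_inequality m x0 C \<longleftrightarrow>
     (\<forall>u\<in>Lip_c.
        (\<integral>\<^sup>+ x. (local_lip u x)\<^sup>2 \<partial>m) * (\<integral>\<^sup>+ x. ennreal ((dist x0 x)\<^sup>2 * (u x)\<^sup>2) \<partial>m)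
        \<ge> ennreal C * (\<integral>\<^sup>+ x. ennreal ((u x)\<^sup>2) \<partial>m)\<^sup>2)"

definition volume_cone :: "real \<Rightarrow> 'a::metric_space measure \<Rightarrow> bool" where
  "volume_cone N m \<longleftrightarrow>
     (\<exists>x0. \<forall>r R. 0 < r \<longrightarrow> r < R \<longrightarrow>
        measure m (ball x0 R) / measure m (ball x0 r) = (R / r) powr N)"

end

theory Submission
  imports Defs
begin

text \<open>
  Everything rests on contracting balls to their centre, which the measure contraction property
  allows with control of the transported measure.

  Evaluated on balls, the contraction gives the volume comparison: \<open>m (ball x r) / r\<^sup>N\<close> is
  nonincreasing in \<open>r\<close> (\<open>Bishop_Gromov\<close>). In particular closed balls are compact.

  The inequality with constant \<open>N\<^sup>2 / 4\<close> implies the cone property. Write \<open>d\<close> for the distance to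
  \<open>x0\<close>. The Gaussian \<open>exp (- d\<^sup>2 / 2)\<close> is a limit of admissible functions, and for it the inequality
  reads \<open>\<integral> (d\<^sup>2 - N / 2) exp (- d\<^sup>2) \<ge> 0\<close>. By the layer cake formula the integral on the left is the
  integral of a weight against the volume function of the balls around \<open>x0\<close>. This weight is
  orthogonal to \<open>r\<^sup>N\<close> and changes sign once, from negative to positive. Against a volume function
  with nonincreasing ratio to \<open>r\<^sup>N\<close> it integrates to something \<open>\<le> 0\<close>, with equality only if the
  ratio is constant (\<open>ratio_constant\<close>). So a single Gaussian detects the cone. In a cone the same
  computation is an equality, and therefore no constant above \<open>N\<^sup>2 / 4\<close> is possible
  (\<open>uncertainty_constant_le\<close>).

  Conversely, in a cone with vertex \<open>x0\<close> the upper bound on the contracted measure is itself a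
  probability measure, so the contraction of a ball by the factor \<open>1 - t\<close> carries the uniform measure
  to the uniform measure of the smaller ball (\<open>volume_cone_pushforward\<close>). Differentiating the integral
  of \<open>u\<^sup>2\<close> along this contraction at \<open>t = 0\<close> yields \<open>N \<integral> u\<^sup>2 \<le> 2 \<integral> d \<bar>u\<bar> lip u\<close>
  (\<open>volume_cone_divergence\<close>), the counterpart of \<open>div (x - x0) = N\<close> in Euclidean space. The
  Cauchy-Schwarz inequality finishes the proof.
\<close>

section \<open>Optimal contraction of balls\<close>

lemma mms_sets:
  "metric_measure_space m \<Longrightarrow> sets m = sets borel"
  by (simp add: metric_measure_space_def radon_measure_def)

lemma mms_space: "metric_measure_space m \<Longrightarrow> space m = UNIV"
  using sets_eq_imp_space_eq[OF mms_sets[of m]] by simp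

lemma mms_ball:
  assumes "metric_measure_space m" "0 < r"
  shows "0 < emeasure m (ball x r)" "emeasure m (ball x r) < \<infinity>"
    "0 < measure m (ball x r)" "emeasure m (ball x r) = ennreal (measure m (ball x r))"
proof -
  have "open (ball x r)" "bounded (ball x r)" "ball x r \<noteq> {}"
    using assms(2) by auto
  with assms(1) show "0 < emeasure m (ball x r)" "emeasure m (ball x r) < \<infinity>"
    unfolding metric_measure_space_def by blast+
  then show "emeasure m (ball x r) = ennreal (measure m (ball x r))"
    by (intro emeasure_eq_ennreal_measure) auto
  with \<open>0 < emeasure m (ball x r)\<close> show "0 < measure m (ball x r)"
    by simp
qed

lemma mms_bounded_finite:
  assumes "metric_measure_space m" "bounded A"
  shows "emeasure m A < \<infinity>"
proof -
  fix x :: 'a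
  obtain r where "0 < r" "A \<subseteq> ball x r"
    using bounded_subset_ballD[OF assms(2), of x] by blast
  then have "emeasure m A \<le> emeasure m (ball x r)"
    using mms_sets[OF assms(1)] by (intro emeasure_mono) auto
  also have "\<dots> < \<infinity>"
    using mms_ball[OF assms(1) \<open>0 < r\<close>] by blast
  finally show ?thesis .
qed

lemma uniform_measure_in_P2:
  assumes "metric_measure_space m" "0 < r"
  shows "uniform_measure m (ball z r) \<in> P2"
proof -
  let ?\<mu> = "uniform_measure m (ball z r)"
  have sets: "sets ?\<mu> = sets borel"
    using mms_sets[OF assms(1)] by simp
  have p: "prob_space ?\<mu>"
    using mms_ball[OF assms, of z] by (intro prob_space_uniform_measure) auto
  have "(\<integral>\<^sup>+ y. ennreal ((dist z y)\<^sup>2) \<partial>?\<mu>) \<le> (\<integral>\<^sup>+ y. ennreal (r\<^sup>2) \<partial>?\<mu>)"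
  proof (intro nn_integral_mono_AE AE_uniform_measureI)
    show "ball z r \<in> sets m"
      using mms_sets[OF assms(1)] by simp
    show "AE x in m. x \<in> ball z r \<longrightarrow> ennreal ((dist z x)\<^sup>2) \<le> ennreal (r\<^sup>2)"
      by (auto intro!: ennreal_leI power_mono)
  qed
  also have "\<dots> < \<infinity>"
    using prob_space.emeasure_space_1[OF p] by simp
  finally show ?thesis
    unfolding P2_def using sets p by (auto simp: space_prob_algebra)
qed

text \<open>
What \<open>MCP0\<close> provides for the normalised restriction of \<open>m\<close> to a ball, contracted to the centre of
that ball: almost every geodesic starts in the ball and ends at the centre. The
same plan serves all times \<open>t\<close>; this is what later allows a derivative at \<open>t = 0\<close>.
\<close>

definition contraction_plan ::
    "real \<Rightarrow> 'a::polish_space measure \<Rightarrow> 'a \<Rightarrow> real \<Rightarrow> (real \<Rightarrow>\<^sub>C 'a) measure \<Rightarrow> bool" where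
  "contraction_plan N m z R \<nu> \<longleftrightarrow>
     prob_space \<nu> \<and> sets \<nu> = sets geo_borel \<and>
     distr \<nu> borel (\<lambda>\<gamma>. apply_bcontfun \<gamma> 0) = uniform_measure m (ball z R) \<and>
     (AE \<gamma> in \<nu>. \<gamma> \<in> Geo \<and> apply_bcontfun \<gamma> 1 = z \<and> dist z (apply_bcontfun \<gamma> 0) < R) \<and>
     (\<forall>t\<in>{0..1}. \<forall>B\<in>sets borel.
        ennreal ((1 - t) powr N) * emeasure (distr \<nu> borel (\<lambda>\<gamma>. apply_bcontfun \<gamma> t)) B
         \<le> emeasure m B / emeasure m (ball z R))"

lemma contraction_plan_measurable:
  assumes "contraction_plan N m z R \<nu>"
  shows "(\<lambda>\<gamma>. apply_bcontfun \<gamma> t) \<in> measurable \<nu> borel"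
proof -
  have "sets \<nu> = sets geo_borel"
    using assms by (simp add: contraction_plan_def)
  then show ?thesis
    using measurable_evaluation measurable_cong_sets by blast
qed

lemma ex_contraction_plan:
  fixes m :: "'a::polish_space measure"
  assumes m: "metric_measure_space m" and "MCP0 N m" and "0 < R"
  shows "\<exists>\<nu>. contraction_plan N m z R \<nu>"
proof -
  let ?A = "ball z R"
  let ?\<mu> = "uniform_measure m ?A"
  note s = mms_sets[OF m] and b = mms_ball[OF m \<open>0 < R\<close>, of z]
  from assms(2)[unfolded MCP0_def, rule_format, of ?A z] b uniform_measure_in_P2[OF m \<open>0 < R\<close>]
  obtain \<nu> where \<nu>: "\<nu> \<in> OptGeo ?\<mu> (return borel z)"
    and le: "\<And>t B. t \<in> {0..1} \<Longrightarrow> B \<in> sets borel \<Longrightarrow>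
      emeasure (distr (scale_measure (ennreal ((1 - t) powr N)) \<nu>) borel
                         (\<lambda>\<gamma>. apply_bcontfun \<gamma> t)) B
             \<le> emeasure (scale_measure (1 / emeasure m ?A) m) B"
    by auto
  from \<nu> have p: "prob_space \<nu>" and sets: "sets \<nu> = sets geo_borel"
    by (auto simp: OptGeo_def space_prob_algebra)
  have ev: "(\<lambda>\<gamma>. apply_bcontfun \<gamma> t) \<in> measurable \<nu> borel" for t
    using measurable_evaluation measurable_cong_sets[OF sets refl] by blast
  let ?e = "\<lambda>\<gamma>. (apply_bcontfun \<gamma> (0::real), apply_bcontfun \<gamma> (1::real))"
  have e: "?e \<in> measurable \<nu> (borel :: ('a \<times> 'a) measure)"
    using measurable_Pair[OF ev ev] by (simp add: borel_prod)
  have c: "distr \<nu> borel ?e \<in> couplings ?\<mu> (return borel z)"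
    using \<nu> by (simp add: OptGeo_def)
  have c0: "distr \<nu> borel (\<lambda>\<gamma>. apply_bcontfun \<gamma> 0) = ?\<mu>"
    using c by (simp add: couplings_def distr_distr[OF _ e] comp_def borel_measurable_continuous_onI
      continuous_on_fst)
  have c1: "distr \<nu> borel (\<lambda>\<gamma>. apply_bcontfun \<gamma> 1) = return borel z"
    using c by (simp add: couplings_def distr_distr[OF _ e] comp_def borel_measurable_continuous_onI
      continuous_on_snd)
  have "AE x in return borel z. x = z"
    by (subst AE_return) auto
  then have 1: "AE \<gamma> in \<nu>. apply_bcontfun \<gamma> 1 = z"
    unfolding c1[symmetric] by (subst (asm) AE_distr_iff) (use ev in auto)
  have "AE x in ?\<mu>. x \<in> ball z R"
    by (intro AE_uniform_measureI) (auto simp: s)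
  then have 2: "AE \<gamma> in \<nu>. apply_bcontfun \<gamma> 0 \<in> ball z R"
    unfolding c0[symmetric] by (subst (asm) AE_distr_iff) (use ev in auto)
  have 3: "AE \<gamma> in \<nu>. \<gamma> \<in> Geo"
    using sets_eq_imp_space_eq[OF sets] by (intro AE_I2) (simp add: geo_borel_def space_restrict_space)
  have 4: "AE \<gamma> in \<nu>. \<gamma> \<in> Geo \<and> apply_bcontfun \<gamma> 1 = z \<and> dist z (apply_bcontfun \<gamma> 0) < R"
    using 1 2 3 by eventually_elim auto
  have "ennreal ((1 - t) powr N) * emeasure (distr \<nu> borel (\<lambda>\<gamma>. apply_bcontfun \<gamma> t)) B
         \<le> emeasure m B / emeasure m (ball z R)"
    if "t \<in> {0..1}" "B \<in> sets borel" for t and B :: "'a set"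
    using le[OF that] that ev[of t]
    by (simp add: emeasure_distr s divide_ennreal_def mult.commute space_scale_measure)
  then show ?thesis
    unfolding contraction_plan_def using p sets c0 4 by blast
qed

lemma Geo_dist:
  assumes "\<gamma> \<in> Geo" "0 \<le> s" "s \<le> 1" "0 \<le> t" "t \<le> 1"
  shows "dist (apply_bcontfun \<gamma> s) (apply_bcontfun \<gamma> t)
    = \<bar>s - t\<bar> * dist (apply_bcontfun \<gamma> 0) (apply_bcontfun \<gamma> 1)"
  using assms(1) unfolding Geo_def mem_Collect_eq
  by (elim conjE) (drule bspec[of _ _ s], use assms(2,3) in simp,
    drule bspec[of _ _ t], use assms(4,5) in auto)

lemma Geo_dist_startpoint:
  assumes "\<gamma> \<in> Geo" "0 \<le> t" "t \<le> 1"
  shows "dist (apply_bcontfun \<gamma> 0) (apply_bcontfun \<gamma> t)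
    = t * dist (apply_bcontfun \<gamma> 0) (apply_bcontfun \<gamma> 1)"
  using Geo_dist[OF assms(1), of 0 t] assms(2,3) by simp

lemma Geo_dist_endpoint:
  assumes "\<gamma> \<in> Geo" "apply_bcontfun \<gamma> 1 = z" "0 \<le> t" "t \<le> 1"
  shows "dist z (apply_bcontfun \<gamma> t) = (1 - t) * dist z (apply_bcontfun \<gamma> 0)"
  using Geo_dist[OF assms(1), of 1 t] assms(2-4) by (simp add: dist_commute)

section \<open>Volume comparison and compactness of balls\<close>

text \<open>
Contract \<open>ball z R\<close> to \<open>z\<close> until the time \<open>t\<close> with \<open>(1 - t) R = r\<close>. All the transported mass then
lies in \<open>ball z r\<close>, so the density bound of the plan, evaluated on \<open>ball z r\<close>, compares the two volumes.
\<close>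

lemma Bishop_Gromov:
  fixes m :: "'a::polish_space measure"
  assumes m: "metric_measure_space m" and mcp: "MCP0 N m" and r: "0 < r" "r \<le> R"
  shows "measure m (ball z R) / R powr N \<le> measure m (ball z r) / r powr N"
proof -
  have R: "0 < R" using r by simp
  obtain \<nu> where plan: "contraction_plan N m z R \<nu>"
    using ex_contraction_plan[OF m mcp R] by blast
  interpret prob_space \<nu> using plan by (simp add: contraction_plan_def)
  define t where "t = 1 - r / R"
  have t: "0 \<le> t" "t \<le> 1" "1 - t = r / R"
    using r R by (auto simp: t_def divide_simps)
  note ev = contraction_plan_measurable[OF plan]
  have "AE \<gamma> in \<nu>. \<gamma> \<in> Geo \<and> apply_bcontfun \<gamma> 1 = z \<and> dist z (apply_bcontfun \<gamma> 0) < R"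
    using plan by (simp add: contraction_plan_def)
  then have "AE \<gamma> in \<nu>. apply_bcontfun \<gamma> t \<in> ball z r"
  proof eventually_elim
    case (elim \<gamma>)
    then have "dist z (apply_bcontfun \<gamma> t) = r / R * dist z (apply_bcontfun \<gamma> 0)"
      using Geo_dist_endpoint[of \<gamma> z t] t by simp
    also have "\<dots> < r / R * R"
      using elim r R by (intro mult_strict_left_mono) auto
    finally show ?case using R by simp
  qed
  then have "emeasure (distr \<nu> borel (\<lambda>\<gamma>. apply_bcontfun \<gamma> t)) (ball z r) = 1"
    using ev by (subst emeasure_distr) (auto intro!: emeasure_eq_1_AE)
  moreover have "ennreal ((1 - t) powr N) * emeasure (distr \<nu> borel (\<lambda>\<gamma>. apply_bcontfun \<gamma> t)) (ball z r)
         \<le> emeasure m (ball z r) / emeasure m (ball z R)"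
    using plan t(1,2) unfolding contraction_plan_def by auto
  ultimately have "ennreal ((r / R) powr N) \<le> emeasure m (ball z r) / emeasure m (ball z R)"
    using t by simp
  also have "\<dots> = ennreal (measure m (ball z r) / measure m (ball z R))"
    using mms_ball[OF m R, of z] mms_ball[OF m r(1), of z]
    by (simp add: divide_ennreal)
  finally have "(r / R) powr N \<le> measure m (ball z r) / measure m (ball z R)"
    by (subst (asm) ennreal_le_iff) auto
  then show ?thesis
    using mms_ball(3)[OF m R, of z] r R by (simp add: powr_divide divide_simps mult.commute)
qed

text \<open>
The volume comparison makes the measure doubling. Hence all balls of radius \<open>e / 2\<close> centred in
\<open>cball z R\<close> carry at least a fixed fraction of the volume of \<open>ball z (R + e)\<close>, and an \<open>e\<close>-separated
subset has a bounded number of points; one with the most points is an \<open>e\<close>-net. Compactness is needed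
to cut Gaussians off to functions in \<open>Lip_c\<close>.
\<close>

lemma compact_cball_of_MCP0:
  fixes m :: "'a::polish_space measure"
  assumes m: "metric_measure_space m" and mcp: "MCP0 N m"
  shows "compact (cball (z::'a) R)"
  unfolding compact_eq_totally_bounded
proof (intro conjI allI impI)
  show "uniform_space_class.complete (cball z R)"
    by (simp add: complete_eq_closed)
  fix e :: real assume e: "0 < e"
  show "\<exists>k. finite k \<and> cball z R \<subseteq> (\<Union>x\<in>k. ball x e)"
  proof (cases "R < 0")
    case True
    then show ?thesis by (intro exI[of _ "{}"]) auto
  next
    case False
    \<comment> \<open>A ball of radius \<open>W\<close> around any point of \<open>cball z R\<close> contains \<open>ball z (R + e)\<close>.\<close>
    define W where "W = 2 * (R + e)"
    have W: "0 < W" "e / 2 \<le> W" using e False by (auto simp: W_def)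
    define V where "V = measure m (ball z (R + e))"
    have V: "0 < V" using mms_ball[OF m, of "R + e" z] e False by (simp add: V_def)
    define c where "c = (e / 2) powr N / W powr N * V"
    have c: "0 < c" using e W V by (simp add: c_def)
    have big: "c \<le> measure m (ball x (e / 2))" if "x \<in> cball z R" for x
    proof -
      have VW: "V \<le> measure m (ball x W)"
        unfolding V_def
      proof (rule measure_mono_fmeasurable)
        show "ball z (R + e) \<subseteq> ball x W"
        proof
          fix y assume "y \<in> ball z (R + e)"
          then have "dist x y < W"
            using that dist_triangle[of x y z] e by (simp add: W_def dist_commute)
          then show "y \<in> ball x W" by simp
        qed
        show "ball x W \<in> fmeasurable m"
          using mms_ball[OF m W(1)] mms_sets[OF m] by (intro fmeasurableI) auto
      qed (simp add: mms_sets[OF m])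
      have BG: "measure m (ball x W) / W powr N \<le> measure m (ball x (e / 2)) / (e / 2) powr N"
        by (rule Bishop_Gromov[OF m mcp]) (use e W in auto)
      have "V / W powr N \<le> measure m (ball x W) / W powr N"
        by (rule divide_right_mono[OF VW]) simp
      also note BG
      finally have "V / W powr N * (e / 2) powr N \<le> measure m (ball x (e / 2))"
        using e by (simp add: pos_le_divide_eq)
      then show ?thesis
        by (simp add: c_def mult.commute)
    qed
    define P where "P S \<longleftrightarrow> finite S \<and> S \<subseteq> cball z R \<and> (\<forall>x\<in>S. \<forall>y\<in>S. x \<noteq> y \<longrightarrow> e \<le> dist x y)" for S
    have bound: "card S \<le> nat \<lfloor>V / c\<rfloor>" if "P S" for S
    proof -
      from that have S: "finite S" "S \<subseteq> cball z R"
        and sep: "\<And>x y. x \<in> S \<Longrightarrow> y \<in> S \<Longrightarrow> x \<noteq> y \<Longrightarrow> e \<le> dist x y"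
        by (auto simp: P_def)
      have fm: "ball x r \<in> fmeasurable m" for x r
        using mms_bounded_finite[OF m, of "ball x r"] mms_sets[OF m] by (intro fmeasurableI) auto
      have "real (card S) * c = (\<Sum>x\<in>S. c)" by simp
      also have "\<dots> \<le> (\<Sum>x\<in>S. measure m (ball x (e / 2)))"
        using S by (intro sum_mono big) auto
      also have "\<dots> = measure m (\<Union>x\<in>S. ball x (e / 2))"
      proof (rule measure_UNION'[symmetric])
        show "pairwise (\<lambda>x y. disjnt (ball x (e / 2)) (ball y (e / 2))) S"
        proof (intro pairwiseI)
          fix x y assume "x \<in> S" "y \<in> S" "x \<noteq> y"
          then have "e \<le> dist x y" by (rule sep)
          then show "disjnt (ball x (e / 2)) (ball y (e / 2))"
            unfolding disjnt_iff using dist_triangle_half_l[of x _ e y]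
            by (auto simp: dist_commute not_less) (metis linorder_not_less)
        qed
      qed (use S fm in auto)
      also have "\<dots> \<le> V"
        unfolding V_def
      proof (rule measure_mono_fmeasurable)
        show "(\<Union>x\<in>S. ball x (e / 2)) \<subseteq> ball z (R + e)"
        proof
          fix y assume "y \<in> (\<Union>x\<in>S. ball x (e / 2))"
          then obtain x where "x \<in> cball z R" "dist x y < e / 2" using S by auto
          then show "y \<in> ball z (R + e)"
            using dist_triangle[of z y x] e by simp
        qed
      qed (use fm S mms_sets[OF m] in \<open>auto intro!: borel_open open_UN\<close>)
      finally have "real (card S) \<le> V / c" using c by (simp add: field_simps)
      then show ?thesis by (simp add: le_nat_floor)
    qed
    have "P {}" by (simp add: P_def)
    then have "\<exists>S. P S \<and> (\<forall>T. P T \<longrightarrow> card T \<le> card S)"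
      by (rule ex_has_greatest_nat[where b = "Suc (nat \<lfloor>V / c\<rfloor>)"]) (use bound in \<open>auto simp: le_imp_less_Suc\<close>)
    then obtain S where S: "P S" and max: "\<And>T. P T \<Longrightarrow> card T \<le> card S"
      by blast
    have "cball z R \<subseteq> (\<Union>x\<in>S. ball x e)"
    proof (rule ccontr)
      assume "\<not> ?thesis"
      then obtain y where y: "y \<in> cball z R" "\<And>x. x \<in> S \<Longrightarrow> e \<le> dist x y"
        by force
      have "y \<notin> S" using y(2)[of y] e by auto
      moreover have "P (insert y S)"
        using S y unfolding P_def by (auto simp: dist_commute)
      ultimately show False
        using max[of "insert y S"] S by (simp add: P_def)
    qed
    then show ?thesis using S by (auto simp: P_def)
  qed
qed

section \<open>Gaussian moments of a radial volume function\<close>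

text \<open>
Completing the square; powers of \<open>r\<close> are at most \<open>exp (c * r)\<close>, so this makes every Gaussian moment
below converge by comparison with \<open>exp (- r)\<close>.
\<close>

lemma Gaussian_dominates_exp:
  fixes c r :: real
  shows "exp (c * r) * exp (- r\<^sup>2) \<le> exp ((c + 1)\<^sup>2 / 4) * exp (- r)"
proof -
  have "0 \<le> ((c + 1) / 2 - r)\<^sup>2" by simp
  then have "c * r - r\<^sup>2 \<le> (c + 1)\<^sup>2 / 4 - r"
    by (simp add: power2_eq_square field_simps)
  then show ?thesis
    by (simp add: mult_exp_exp)
qed

lemma powr_le_exp:
  fixes a r :: real
  assumes "0 \<le> a" "0 < r"
  shows "r powr a \<le> exp (a * r)"
proof -
  have "ln r \<le> r" using ln_le_minus_one[OF assms(2)] by simp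
  then have "a * ln r \<le> a * r" using assms(1) by (rule mult_left_mono)
  then show ?thesis using assms(2) by (simp add: powr_def)
qed

lemma integrable_exp_decay: "set_integrable lborel {0<..} (\<lambda>r::real. exp (- r))"
proof -
  have "(\<integral>\<^sup>+ r. ennreal (exp (- r)) * indicator {0::real..} r \<partial>lborel) = ennreal (0 - (- exp (- 0)))"
  proof (rule nn_integral_FTC_atLeast)
    show "((\<lambda>x::real. - exp (- x)) \<longlongrightarrow> 0) at_top"
      using tendsto_minus[OF filterlim_compose[OF exp_at_bot filterlim_uminus_at_bot_at_top]]
      by simp
  qed (auto intro!: derivative_eq_intros)
  then have "set_integrable lborel {0..} (\<lambda>r::real. exp (- r))"
    unfolding set_integrable_def
    by (intro integrableI_bounded) (auto simp: nn_integral_set_ennreal indicator_mult_ennreal mult.commute abs_mult ennreal_mult' cong: nn_integral_cong)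
  then show ?thesis
    by (rule set_integrable_subset) auto
qed

lemma positive_length_meets_AE:
  fixes a b :: real
  assumes "AE r in lborel. P r" "a < b"
  shows "\<exists>r. a < r \<and> r < b \<and> P r"
proof (rule ccontr)
  assume *: "\<not> ?thesis"
  from assms(1) have "AE r in lborel. r \<notin> {a<..<b}"
    by eventually_elim (use * in auto)
  then have "emeasure lborel {a<..<b} = 0"
    by (subst (asm) AE_iff_measurable[of "{a<..<b}"]) auto
  then show False using assms(2) by simp
qed

text \<open>
The properties of the volume \<open>v r\<close> of a ball of radius \<open>r\<close> that the one-dimensional argument uses:
monotonicity and the volume comparison.
\<close>

locale radial_volume =
  fixes N :: real and v :: "real \<Rightarrow> real"
  assumes N: "0 \<le> N"
    and mono: "\<And>r s. r \<le> s \<Longrightarrow> v r \<le> v s"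
    and zero: "\<And>r. r \<le> 0 \<Longrightarrow> v r = 0"
    and ratio_antimono: "\<And>r s. 0 < r \<Longrightarrow> r \<le> s \<Longrightarrow> v s / s powr N \<le> v r / r powr N"
begin

lemma nonneg: "0 \<le> v r"
  using mono[of 0 r] mono[of r 0] zero[of 0] zero[of r] by linarith

lemma measurable_volume [measurable]: "v \<in> borel_measurable borel"
  by (rule borel_measurable_mono) (simp add: mono_def mono)

lemma le_exp: 
  assumes "0 < r" shows "v r \<le> v 1 * exp (N * r)"
proof (cases "r \<le> 1")
  case True
  have "v r \<le> v 1 * 1" using mono[OF True] by simp
  also have "\<dots> \<le> v 1 * exp (N * r)"
    using assms N nonneg[of 1] by (intro mult_left_mono) auto
  finally show ?thesis .
next
  case False
  then have "v r \<le> v 1 * r powr N"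
    using ratio_antimono[of 1 r] assms by (simp add: field_simps)
  also have "\<dots> \<le> v 1 * exp (N * r)"
    using powr_le_exp[OF N assms] nonneg[of 1] by (intro mult_left_mono) auto
  finally show ?thesis .
qed

lemma integrable_moment:
  assumes [measurable]: "p \<in> borel_measurable borel" and p: "\<And>r. 0 < r \<Longrightarrow> \<bar>p r\<bar> \<le> C * exp (k * r)"
  shows "integrable lborel (\<lambda>r. p r * exp (- r\<^sup>2) * v r)"
proof (rule Bochner_Integration.integrable_bound)
  define K where "K = C * v 1 * exp ((k + N + 1)\<^sup>2 / 4)"
  show "integrable lborel (\<lambda>r. K * (indicator {0<..} r * exp (- r)))"
    using integrable_exp_decay by (simp add: set_integrable_def)
  show "AE r in lborel. norm (p r * exp (- r\<^sup>2) * v r)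
      \<le> norm (K * (indicator {0<..} r * exp (- r)))"
  proof (rule AE_I2)
    fix r :: real
    show "norm (p r * exp (- r\<^sup>2) * v r) \<le> norm (K * (indicator {0<..} r * exp (- r)))"
    proof (cases "0 < r")
      case False
      then show ?thesis using zero[of r] by simp
    next
      case True
      have C: "0 \<le> C" using p[OF True] by (smt (verit) exp_gt_zero mult_neg_pos)
      have "norm (p r * exp (- r\<^sup>2) * v r) = \<bar>p r\<bar> * exp (- r\<^sup>2) * v r"
        using nonneg[of r] by (simp add: abs_mult)
      also have "\<dots> \<le> (C * exp (k * r)) * exp (- r\<^sup>2) * (v 1 * exp (N * r))"
        using p[OF True] le_exp[OF True] nonneg[of r] C by (intro mult_mono) auto
      also have "\<dots> = C * v 1 * (exp ((k + N) * r) * exp (- r\<^sup>2))"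
        by (simp add: distrib_right exp_add)
      also have "\<dots> \<le> C * v 1 * (exp ((k + N + 1)\<^sup>2 / 4) * exp (- r))"
        using C nonneg[of 1] Gaussian_dominates_exp by (intro mult_left_mono) auto
      also have "\<dots> \<le> norm (K * (indicator {0<..} r * exp (- r)))"
        using True by (simp add: K_def mult.assoc)
      finally show ?thesis .
    qed
  qed
qed auto

lemma integrable_moment_3: "integrable lborel (\<lambda>r. 2 * r ^ 3 * exp (- r\<^sup>2) * v r)"
proof (rule integrable_moment)
  show "\<bar>2 * r ^ 3\<bar> \<le> 2 * exp (3 * r)" if "0 < r" for r :: real
    using powr_le_exp[of 3 r] that by (simp add: powr_numeral)
qed simp

lemma integrable_moment_1: "integrable lborel (\<lambda>r. 2 * r * exp (- r\<^sup>2) * v r)"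
proof (rule integrable_moment)
  show "\<bar>2 * r\<bar> \<le> 2 * exp (1 * r)" if "0 < r" for r :: real
    using powr_le_exp[of 1 r] that by simp
qed simp

end

text \<open>
This is the derivative of \<open>- (r\<^sup>2 - N / 2) * exp (- r\<^sup>2)\<close>. By the layer cake formula its integral
against \<open>v\<close> is therefore the integral of \<open>(d\<^sup>2 - N / 2) * exp (- d\<^sup>2)\<close> over the space, \<open>d\<close> being the
distance to the centre. On the positive axis its only sign change, from negative to positive, is
at \<open>sqrt (N / 2 + 1)\<close>.
\<close>

definition cone_weight :: "real \<Rightarrow> real \<Rightarrow> real" where
  "cone_weight N r = 2 * r * (r\<^sup>2 - (N / 2 + 1)) * exp (- r\<^sup>2)"

lemma (in radial_volume) integrable_cone_weight: "integrable lborel (\<lambda>r. cone_weight N r * v r)"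
proof -
  have "cone_weight N r * v r
      = 2 * r ^ 3 * exp (- r\<^sup>2) * v r - (N / 2 + 1) * (2 * r * exp (- r\<^sup>2) * v r)" for r
    by (simp add: cone_weight_def algebra_simps power2_eq_square power3_eq_cube)
  then show ?thesis
    using integrable_moment_3 integrable_moment_1 by simp
qed

lemma radial_volume_powr:
  assumes "0 \<le> N"
  shows "radial_volume N (\<lambda>r. if r \<le> 0 then 0 else r powr N)"
proof
  show "0 \<le> N" by fact
  show "(if s \<le> 0 then 0 else s powr N) / s powr N \<le> (if r \<le> 0 then 0 else r powr N) / r powr N"
    if "0 < r" "r \<le> s" for r s
    using that by simp
qed (use assms in \<open>auto intro!: powr_mono2\<close>)

text \<open>
In an exact cone the second Gaussian moment is \<open>N / 2\<close> times the mass. In one dimension this holds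
because \<open>- (r powr (N + 2)) * exp (- r\<^sup>2)\<close>, which vanishes at \<open>0\<close> and at infinity, is a primitive
of the integrand.
\<close>

lemma integral_cone_weight_powr:
  fixes N :: real
  assumes N: "0 \<le> N"
  shows "(LINT r|lborel. cone_weight N r * (if r \<le> 0 then 0 else r powr N)) = 0"
proof -
  define f where "f = (\<lambda>r. cone_weight N r * r powr N)"
  define F where "F r = - (r powr (N + 2)) * exp (- r\<^sup>2)" for r :: real
  interpret radial_volume N "\<lambda>r. if r \<le> 0 then 0 else r powr N"
    using radial_volume_powr[OF N] by simp
  have eq: "cone_weight N r * (if r \<le> 0 then 0 else r powr N) = indicator {0<..} r *\<^sub>R f r" for r
    by (auto simp: f_def)
  have einterval: "einterval 0 \<infinity> = {0<..}"
    by (auto simp: einterval_def)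
  have "(LBINT r=0..\<infinity>. f r) = 0 - 0"
  proof (rule interval_integral_FTC_integrable)
    show "set_integrable lborel (einterval 0 \<infinity>) f"
      using integrable_cone_weight unfolding set_integrable_def einterval eq .
    show "(F has_vector_derivative f x) (at x)" if "0 < ereal x" for x
    proof -
      have x: "0 < x" using that by simp
      have e: "x powr (N + 2) = x powr N * x\<^sup>2" "x powr (1 + N) = x powr N * x"
        using x by (simp_all add: powr_add powr_numeral)
      show ?thesis
        unfolding F_def has_real_derivative_iff_has_vector_derivative[symmetric] f_def cone_weight_def
        using x
        apply (auto intro!: derivative_eq_intros)
        apply (simp add: e algebra_simps power2_eq_square)
        done
    qed
    show "isCont f x" if "0 < ereal x" for x
      using that unfolding f_def cone_weight_def by (auto intro!: continuous_intros)
    have "((\<lambda>x. - (x powr (N + 2)) * exp (- x\<^sup>2)) \<longlongrightarrow> - 0 * exp (- 0\<^sup>2)) (at_right (0::real))"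
      using N by (intro tendsto_intros tendsto_zero_powrI) (auto simp: eventually_at_right_field intro: tendsto_eq_intros exI[of _ 1])
    then show "((F \<circ> real_of_ereal) \<longlongrightarrow> 0) (at_right 0)"
      unfolding zero_ereal_def ereal_tendsto_simps1 F_def[abs_def] by simp
    have "((\<lambda>r. exp ((N + 2 + 1)\<^sup>2 / 4) * exp (- r)) \<longlongrightarrow> exp ((N + 2 + 1)\<^sup>2 / 4) * 0) at_top"
      by (intro tendsto_intros filterlim_compose[OF exp_at_bot filterlim_uminus_at_bot_at_top])
    moreover have "\<forall>\<^sub>F r in at_top. norm (F r) \<le> exp ((N + 2 + 1)\<^sup>2 / 4) * exp (- r)"
      using eventually_gt_at_top[of 0]
    proof eventually_elim
      case (elim r)
      have "norm (F r) \<le> exp ((N + 2) * r) * exp (- r\<^sup>2)"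
        using powr_le_exp[of "N + 2" r] N elim by (simp add: F_def abs_mult)
      also have "\<dots> \<le> exp ((N + 2 + 1)\<^sup>2 / 4) * exp (- r)"
        by (rule Gaussian_dominates_exp)
      finally show ?case .
    qed
    ultimately have "(F \<longlongrightarrow> 0) at_top"
      by (simp add: Lim_null_comparison)
    then show "((F \<circ> real_of_ereal) \<longlongrightarrow> 0) (at_left \<infinity>)"
      by (simp add: ereal_tendsto_simps1)
  qed auto
  then show ?thesis
    unfolding eq by (simp add: interval_lebesgue_integral_def einterval set_lebesgue_integral_def)
qed

context radial_volume begin

text \<open>
The weight has integral zero against \<open>r powr N\<close>, is negative before \<open>\<rho> = sqrt (N / 2 + 1)\<close> and
positive after it. A decreasing ratio \<open>v r / r powr N\<close> puts more than its value at \<open>\<rho>\<close> where the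
weight is negative, and less where it is positive, so the integral against \<open>v\<close> is at most zero. If
it is not negative, the ratio equals its value at \<open>\<rho>\<close> almost everywhere, and by monotonicity
everywhere.
\<close>

lemma ratio_constant:
  assumes "0 \<le> (LINT r|lborel. cone_weight N r * v r)" and "0 < r1"
  shows "v r1 / r1 powr N = v (sqrt (N / 2 + 1)) / sqrt (N / 2 + 1) powr N"
proof -
  define \<rho> where "\<rho> = sqrt (N / 2 + 1)"
  have \<rho>: "0 < \<rho>" "\<rho>\<^sup>2 = N / 2 + 1" using N by (auto simp: \<rho>_def)
  define c where "c = v \<rho> / \<rho> powr N"
  define q where "q r = (if r \<le> 0 then 0 else r powr N)" for r :: real
  have c: "0 \<le> c" using nonneg[of \<rho>] by (simp add: c_def)
  interpret q: radial_volume N q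
    using radial_volume_powr[OF N] by (simp add: q_def[abs_def])
  define g where "g r = cone_weight N r * (c * q r - v r)" for r
  have g_int: "integrable lborel g"
    using integrable_cone_weight q.integrable_cone_weight
    by (simp add: g_def[abs_def] right_diff_distrib mult.left_commute)
  have low: "c \<le> v r / r powr N" if "0 < r" "r \<le> \<rho>" for r
    using ratio_antimono[of r \<rho>] that by (simp add: c_def)
  have high: "v r / r powr N \<le> c" if "\<rho> \<le> r" for r
    using ratio_antimono[of \<rho> r] that \<rho> by (simp add: c_def)
  have g_nonneg: "0 \<le> g r" for r
  proof -
    consider "r \<le> 0" | "0 < r" "r \<le> \<rho>" | "\<rho> \<le> r" by linarith
    then show ?thesis
    proof cases
      case 1 then show ?thesis using zero[of r] by (simp add: g_def q_def)
    next
      case 2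
      then have "r\<^sup>2 \<le> \<rho>\<^sup>2" by (intro power_mono) auto
      then have "cone_weight N r \<le> 0"
        using 2 \<rho> by (simp add: cone_weight_def mult_nonneg_nonpos mult_nonpos_nonneg)
      moreover have "c * q r - v r \<le> 0"
        using low[OF 2] 2 by (simp add: q_def field_simps)
      ultimately show ?thesis by (simp add: g_def mult_nonpos_nonpos)
    next
      case 3
      then have "\<rho>\<^sup>2 \<le> r\<^sup>2" using \<rho> by (intro power_mono) auto
      then have "0 \<le> cone_weight N r"
        using 3 \<rho> by (simp add: cone_weight_def)
      moreover have "0 \<le> c * q r - v r"
        using high[OF 3] 3 \<rho> by (simp add: q_def field_simps)
      ultimately show ?thesis by (simp add: g_def)
    qed
  qed
  have "(LINT r|lborel. g r) = c * (LINT r|lborel. cone_weight N r * q r) - (LINT r|lborel. cone_weight N r * v r)"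
    using integrable_cone_weight q.integrable_cone_weight
    by (simp add: g_def[abs_def] right_diff_distrib mult.left_commute)
  also have "\<dots> \<le> 0"
    using integral_cone_weight_powr[OF N] assms(1) by (simp add: q_def[abs_def])
  finally have "(LINT r|lborel. g r) = 0"
    using g_nonneg by (simp add: antisym integral_nonneg_AE)
  then have "AE r in lborel. g r = 0"
    using integral_nonneg_eq_0_iff_AE[OF g_int] g_nonneg by simp
  then have AE: "AE r in lborel. 0 < r \<longrightarrow> r \<noteq> \<rho> \<longrightarrow> v r / r powr N = c"
  proof eventually_elim
    case (elim r)
    show ?case
    proof (intro impI)
      assume r: "0 < r" "r \<noteq> \<rho>"
      then have "r\<^sup>2 \<noteq> \<rho>\<^sup>2" using \<rho>(1) by (auto simp: power2_eq_iff)
      then have "cone_weight N r \<noteq> 0"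
        using r \<rho> by (simp add: cone_weight_def)
      then have "c * q r = v r" using elim by (simp add: g_def)
      then show "v r / r powr N = c" using r by (simp add: q_def field_simps)
    qed
  qed
  have "v r1 / r1 powr N = c"
  proof (cases "r1 \<le> \<rho>")
    case True
    obtain r where r: "0 < r" "r < r1" "0 < r \<longrightarrow> r \<noteq> \<rho> \<longrightarrow> v r / r powr N = c"
      using positive_length_meets_AE[OF AE assms(2)] by blast
    then have "v r1 / r1 powr N \<le> c"
      using ratio_antimono[of r r1] True by auto
    then show ?thesis using low[OF assms(2) True] by simp
  next
    case False
    obtain r where r: "r1 < r" "0 < r \<longrightarrow> r \<noteq> \<rho> \<longrightarrow> v r / r powr N = c"
      using positive_length_meets_AE[OF AE, of r1 "r1 + 1"] by auto
    then have "c \<le> v r1 / r1 powr N"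
      using ratio_antimono[of r1 r] assms(2) False by auto
    then show ?thesis using high[of r1] False by simp
  qed
  then show ?thesis by (simp add: c_def \<rho>_def)
qed

end

section \<open>Gaussians on the space and volume cones\<close>

lemma mms_sigma_finite:
  assumes m: "metric_measure_space m"
  shows "sigma_finite_measure m"
proof
  fix x :: 'a
  show "\<exists>A. countable A \<and> A \<subseteq> sets m \<and> \<Union> A = space m \<and> (\<forall>a\<in>A. emeasure m a \<noteq> \<infinity>)"
  proof (intro exI[of _ "range (\<lambda>n::nat. ball x n)"] conjI ballI)
    show "\<Union> (range (\<lambda>n::nat. ball x n)) = space m"
    proof -
      have "\<exists>n::nat. y \<in> ball x n" for y
        using reals_Archimedean2[of "dist x y"] by simp
      then show ?thesis by (auto simp: mms_space[OF m])
    qed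
  next
    fix a assume "a \<in> range (\<lambda>n::nat. ball x n)"
    then have "bounded a" by auto
    then show "emeasure m a \<noteq> \<infinity>"
      using mms_bounded_finite[OF m] by (simp add: less_top)
  qed (auto simp: mms_sets[OF m])
qed

text \<open>
Layer cake formula: write the radial function \<open>H\<close> as the integral of \<open>h\<close> over \<open>r > dist x0 x\<close> and
exchange the two integrals.
\<close>

lemma nn_integral_radial:
  fixes m :: "'a::polish_space measure" and h H :: "real \<Rightarrow> real"
  assumes m: "metric_measure_space m"
    and [measurable]: "h \<in> borel_measurable borel"
    and H: "\<And>s. 0 \<le> s \<Longrightarrow> (\<integral>\<^sup>+ r. ennreal (h r) * indicator {s..} r \<partial>lborel) = ennreal (H s)"
  shows "(\<integral>\<^sup>+ x. ennreal (H (dist x0 x)) \<partial>m)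
    = (\<integral>\<^sup>+ r. ennreal (h r) * emeasure m (ball x0 r) \<partial>lborel)"
proof -
  interpret m: sigma_finite_measure m by (rule mms_sigma_finite[OF m])
  interpret pair_sigma_finite m lborel ..
  note s[measurable_cong] = mms_sets[OF m]
  have "(\<integral>\<^sup>+ x. ennreal (H (dist x0 x)) \<partial>m)
      = (\<integral>\<^sup>+ x. (\<integral>\<^sup>+ r. ennreal (h r) * indicator {dist x0 x<..} r \<partial>lborel) \<partial>m)"
  proof (rule nn_integral_cong)
    fix x
    have "AE r in lborel. r \<noteq> dist x0 x" by (rule AE_lborel_singleton)
    then have "AE r in lborel. ennreal (h r) * indicator {dist x0 x..} r
        = ennreal (h r) * indicator {dist x0 x<..} r"
      by eventually_elim (auto simp: indicator_def)
    from nn_integral_cong_AE[OF this] H[of "dist x0 x"]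
    show "ennreal (H (dist x0 x)) = (\<integral>\<^sup>+ r. ennreal (h r) * indicator {dist x0 x<..} r \<partial>lborel)"
      by simp
  qed
  also have "\<dots> = (\<integral>\<^sup>+ x. (\<integral>\<^sup>+ r. ennreal (h r) * (if dist x0 x < r then 1 else 0) \<partial>lborel) \<partial>m)"
    by (intro nn_integral_cong) (simp add: indicator_def)
  also have "\<dots> = (\<integral>\<^sup>+ r. (\<integral>\<^sup>+ x. ennreal (h r) * (if dist x0 x < r then 1 else 0) \<partial>m) \<partial>lborel)"
    by (rule Fubini'[symmetric]) measurable
  also have "\<dots> = (\<integral>\<^sup>+ r. ennreal (h r) * emeasure m (ball x0 r) \<partial>lborel)"
  proof (rule nn_integral_cong)
    fix r :: real
    have "(\<integral>\<^sup>+ x. ennreal (h r) * (if dist x0 x < r then 1 else 0) \<partial>m)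
        = (\<integral>\<^sup>+ x. ennreal (h r) * indicator (ball x0 r) x \<partial>m)"
      by (intro nn_integral_cong) (simp add: indicator_def)
    also have "\<dots> = ennreal (h r) * emeasure m (ball x0 r)"
      using s by (simp add: nn_integral_cmult_indicator)
    finally show "(\<integral>\<^sup>+ x. ennreal (h r) * (if dist x0 x < r then 1 else 0) \<partial>m) = \<dots>" .
  qed
  finally show ?thesis .
qed

text \<open>
The two layer cake representations used for \<open>exp (- s\<^sup>2)\<close> and \<open>s\<^sup>2 * exp (- s\<^sup>2)\<close>. For the latter,
\<open>exp (- s\<^sup>2)\<close> is added so that the density is nonnegative, which Tonelli's theorem asks for.
\<close>

lemma Gaussian_tails:
  fixes s :: real
  assumes "0 \<le> s"
  shows "(\<integral>\<^sup>+ r. ennreal (2 * r * exp (- r\<^sup>2)) * indicator {s..} r \<partial>lborel) = ennreal (exp (- s\<^sup>2))"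
    and "(\<integral>\<^sup>+ r. ennreal (2 * r ^ 3 * exp (- r\<^sup>2)) * indicator {s..} r \<partial>lborel)
      = ennreal ((s\<^sup>2 + 1) * exp (- s\<^sup>2))"
proof -
  have lim: "((\<lambda>r::real. exp (c * r) * exp (- r\<^sup>2)) \<longlongrightarrow> 0) at_top" for c
  proof (rule Lim_null_comparison)
    show "\<forall>\<^sub>F r in at_top. norm (exp (c * r) * exp (- r\<^sup>2)) \<le> exp ((c + 1)\<^sup>2 / 4) * exp (- r)"
      using Gaussian_dominates_exp by (simp add: abs_mult)
    show "((\<lambda>r. exp ((c + 1)\<^sup>2 / 4) * exp (- r)) \<longlongrightarrow> 0) at_top"
      by (intro tendsto_mult_right_zero filterlim_compose[OF exp_at_bot filterlim_uminus_at_bot_at_top])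
  qed
  have "(\<integral>\<^sup>+ r. ennreal (2 * r * exp (- r\<^sup>2)) * indicator {s..} r \<partial>lborel) = 0 - (- exp (- s\<^sup>2))"
  proof (rule nn_integral_FTC_atLeast)
    show "((\<lambda>r::real. - exp (- r\<^sup>2)) \<longlongrightarrow> 0) at_top"
      using tendsto_minus[OF lim[of 0]] by simp
  qed (use assms in \<open>auto intro!: derivative_eq_intros\<close>)
  then show "(\<integral>\<^sup>+ r. ennreal (2 * r * exp (- r\<^sup>2)) * indicator {s..} r \<partial>lborel) = ennreal (exp (- s\<^sup>2))"
    by simp
  have "(\<integral>\<^sup>+ r. ennreal (2 * r ^ 3 * exp (- r\<^sup>2)) * indicator {s..} r \<partial>lborel)
      = 0 - (- ((s\<^sup>2 + 1) * exp (- s\<^sup>2)))"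
  proof (rule nn_integral_FTC_atLeast)
    show "((\<lambda>r::real. - ((r\<^sup>2 + 1) * exp (- r\<^sup>2))) \<longlongrightarrow> 0) at_top"
    proof (rule Lim_null_comparison[OF _ lim[of 2]])
      show "\<forall>\<^sub>F r::real in at_top. norm (- ((r\<^sup>2 + 1) * exp (- r\<^sup>2))) \<le> exp (2 * r) * exp (- r\<^sup>2)"
        using eventually_ge_at_top[of 0]
      proof eventually_elim
        case (elim r)
        have "1 + r \<le> exp r" by (rule exp_ge_add_one_self)
        then have "(1 + r)\<^sup>2 \<le> (exp r)\<^sup>2" using elim by (intro power_mono) auto
        moreover have "(exp r)\<^sup>2 = exp (2 * r)"
          by (simp add: exp_double)
        moreover have "r\<^sup>2 + 1 \<le> (1 + r)\<^sup>2" using elim by (simp add: power2_eq_square algebra_simps)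
        ultimately show ?case by (simp add: abs_mult)
      qed
    qed
  qed (use assms in \<open>auto intro!: derivative_eq_intros simp: algebra_simps power2_eq_square power3_eq_cube\<close>)
  then show "(\<integral>\<^sup>+ r. ennreal (2 * r ^ 3 * exp (- r\<^sup>2)) * indicator {s..} r \<partial>lborel)
      = ennreal ((s\<^sup>2 + 1) * exp (- s\<^sup>2))"
    by simp
qed

lemma ball_radial_volume:
  fixes m :: "'a::polish_space measure"
  assumes m: "metric_measure_space m" and "MCP0 N m" "0 \<le> N"
  shows "radial_volume N (\<lambda>r. measure m (ball x0 r))"
proof
  show "measure m (ball x0 r) \<le> measure m (ball x0 s)" if "r \<le> s" for r s
  proof (rule measure_mono_fmeasurable)
    show "ball x0 s \<in> fmeasurable m"
      using mms_bounded_finite[OF m, of "ball x0 s"] mms_sets[OF m] by (intro fmeasurableI) auto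
  qed (use that mms_sets[OF m] in auto)
  show "measure m (ball x0 r) = 0" if "r \<le> 0" for r
    by (simp add: ball_empty[OF that])
qed (use assms Bishop_Gromov in auto)

lemma Gaussian_moments:
  fixes m :: "'a::polish_space measure"
  assumes m: "metric_measure_space m" and mcp: "MCP0 N m" and N: "0 \<le> N"
  shows "integrable m (\<lambda>x. exp (- (dist x0 x)\<^sup>2))"
    and "integrable m (\<lambda>x. (dist x0 x)\<^sup>2 * exp (- (dist x0 x)\<^sup>2))"
    and "(LINT x|m. (dist x0 x)\<^sup>2 * exp (- (dist x0 x)\<^sup>2)) - N / 2 * (LINT x|m. exp (- (dist x0 x)\<^sup>2))
      = (LINT r|lborel. cone_weight N r * measure m (ball x0 r))"
proof -
  define v where "v r = measure m (ball x0 r)" for r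
  interpret radial_volume N v
    unfolding v_def[abs_def] by (rule ball_radial_volume[OF m mcp N])
  note s[measurable_cong] = mms_sets[OF m]
  have ev: "emeasure m (ball x0 r) = ennreal (v r)" for r
    using mms_bounded_finite[OF m, of "ball x0 r"] by (simp add: v_def emeasure_eq_ennreal_measure less_top)
  have nn: "has_bochner_integral m (\<lambda>x. H (dist x0 x)) (LINT r|lborel. h r * v r)"
    if "h \<in> borel_measurable borel" "H \<in> borel_measurable borel" "integrable lborel (\<lambda>r. h r * v r)"
      "\<And>s. 0 \<le> s \<Longrightarrow> 0 \<le> H s" "\<And>s. 0 \<le> s \<Longrightarrow> 0 \<le> h s"
      "\<And>s. 0 \<le> s \<Longrightarrow> (\<integral>\<^sup>+ r. ennreal (h r) * indicator {s..} r \<partial>lborel) = ennreal (H s)" for h H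
  proof (rule has_bochner_integral_nn_integral)
    have nonneg': "0 \<le> h r * v r" for r
      using that(5)[of r] zero[of r] nonneg[of r] by (cases "0 \<le> r") auto
    note [measurable] = that(2)
    show "(\<lambda>x. H (dist x0 x)) \<in> borel_measurable m" by measurable
    have "(\<integral>\<^sup>+ x. ennreal (H (dist x0 x)) \<partial>m) = (\<integral>\<^sup>+ r. ennreal (h r) * emeasure m (ball x0 r) \<partial>lborel)"
      by (rule nn_integral_radial[OF m that(1) that(6)])
    also have "\<dots> = (\<integral>\<^sup>+ r. ennreal (h r * v r) \<partial>lborel)"
      using nonneg by (simp add: ev ennreal_mult'')
    also have "\<dots> = ennreal (LINT r|lborel. h r * v r)"
      using that(3) nonneg' by (intro nn_integral_eq_integral) auto
    finally show "(\<integral>\<^sup>+ x. ennreal (H (dist x0 x)) \<partial>m) = ennreal (LINT r|lborel. h r * v r)" .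
    show "0 \<le> (LINT r|lborel. h r * v r)"
      using nonneg' by (intro integral_nonneg_AE) auto
  qed (use that in auto)
  have 1: "has_bochner_integral m (\<lambda>x. exp (- (dist x0 x)\<^sup>2)) (LINT r|lborel. 2 * r * exp (- r\<^sup>2) * v r)"
    by (rule nn[OF _ _ integrable_moment_1 _ _ Gaussian_tails(1)]) auto
  have 2: "has_bochner_integral m (\<lambda>x. ((dist x0 x)\<^sup>2 + 1) * exp (- (dist x0 x)\<^sup>2))
      (LINT r|lborel. 2 * r ^ 3 * exp (- r\<^sup>2) * v r)"
    by (rule nn[OF _ _ integrable_moment_3 _ _ Gaussian_tails(2)]) auto
  have 3: "has_bochner_integral m (\<lambda>x. (dist x0 x)\<^sup>2 * exp (- (dist x0 x)\<^sup>2))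
      ((LINT r|lborel. 2 * r ^ 3 * exp (- r\<^sup>2) * v r) - (LINT r|lborel. 2 * r * exp (- r\<^sup>2) * v r))"
    using has_bochner_integral_diff[OF 2 1] by (simp add: algebra_simps)
  have "cone_weight N r * v r
      = 2 * r ^ 3 * exp (- r\<^sup>2) * v r - (N / 2 + 1) * (2 * r * exp (- r\<^sup>2) * v r)" for r
    by (simp add: cone_weight_def algebra_simps power2_eq_square power3_eq_cube)
  then have "(LINT r|lborel. cone_weight N r * v r)
      = (LINT r|lborel. 2 * r ^ 3 * exp (- r\<^sup>2) * v r)
        - (N / 2 + 1) * (LINT r|lborel. 2 * r * exp (- r\<^sup>2) * v r)"
    using integrable_moment_3 integrable_moment_1 by simp
  moreover note has_bochner_integral_integral_eq[OF 1] has_bochner_integral_integral_eq[OF 3]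
  ultimately show "(LINT x|m. (dist x0 x)\<^sup>2 * exp (- (dist x0 x)\<^sup>2)) - N / 2 * (LINT x|m. exp (- (dist x0 x)\<^sup>2))
      = (LINT r|lborel. cone_weight N r * measure m (ball x0 r))"
    by (simp add: v_def algebra_simps)
  show "integrable m (\<lambda>x. exp (- (dist x0 x)\<^sup>2))"
    and "integrable m (\<lambda>x. (dist x0 x)\<^sup>2 * exp (- (dist x0 x)\<^sup>2))"
    by (rule integrable.intros[OF 1], rule integrable.intros[OF 3])
qed

lemma Gaussian_mass_pos:
  assumes m: "metric_measure_space m" and "integrable m (\<lambda>x. exp (- (dist x0 x)\<^sup>2))"
  shows "0 < (LINT x|m. exp (- (dist x0 x)\<^sup>2))"
proof -
  have "(LINT x|m. exp (- (dist x0 x)\<^sup>2)) \<noteq> 0"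
  proof
    assume "(LINT x|m. exp (- (dist x0 x)\<^sup>2)) = 0"
    then have "AE x in m. exp (- (dist x0 x)\<^sup>2) = 0"
      using integral_nonneg_eq_0_iff_AE[OF assms(2)] by simp
    then have "AE x in m. False" by eventually_elim simp
    then have "emeasure m (space m) = 0"
      by (subst (asm) AE_iff_measurable[of "space m"]) auto
    moreover have "emeasure m (ball x0 1) \<le> emeasure m (space m)"
      by (rule emeasure_space)
    ultimately show False
      using mms_ball(1)[OF m, of 1 x0] by simp
  qed
  moreover have "0 \<le> (LINT x|m. exp (- (dist x0 x)\<^sup>2))"
    by (rule Bochner_Integration.integral_nonneg) simp
  ultimately show ?thesis by linarith
qed

text \<open>
The vertex is made explicit because both directions of the theorem keep the same point.
\<close>

definition volume_cone_at :: "real \<Rightarrow> 'a::metric_space measure \<Rightarrow> 'a \<Rightarrow> bool" where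
  "volume_cone_at N m x0 \<longleftrightarrow>
     (\<forall>r R. 0 < r \<longrightarrow> r < R \<longrightarrow> measure m (ball x0 R) / measure m (ball x0 r) = (R / r) powr N)"

lemma volume_cone_iff: "volume_cone N m \<longleftrightarrow> (\<exists>x0. volume_cone_at N m x0)"
  by (simp add: volume_cone_def volume_cone_at_def)

lemma volume_cone_at_iff:
  assumes m: "metric_measure_space m"
  shows "volume_cone_at N m x0 \<longleftrightarrow> (\<forall>r>0. measure m (ball x0 r) = measure m (ball x0 1) * r powr N)"
proof
  assume c: "volume_cone_at N m x0"
  show "\<forall>r>0. measure m (ball x0 r) = measure m (ball x0 1) * r powr N"
  proof (intro allI impI)
    fix r :: real assume r: "0 < r"
    consider "r < 1" | "r = 1" | "1 < r" by linarith
    then show "measure m (ball x0 r) = measure m (ball x0 1) * r powr N"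
    proof cases
      case 1
      then have "measure m (ball x0 1) / measure m (ball x0 r) = (1 / r) powr N"
        using c r by (simp add: volume_cone_at_def)
      then show ?thesis
        using mms_ball(3)[OF m r, of x0] r by (simp add: powr_divide field_simps)
    next
      case 3
      then have "measure m (ball x0 r) / measure m (ball x0 1) = (r / 1) powr N"
        using c[unfolded volume_cone_at_def, rule_format, of 1 r] by simp
      then show ?thesis
        using mms_ball(3)[OF m, of 1 x0] by (simp add: field_simps)
    qed simp
  qed
next
  assume c: "\<forall>r>0. measure m (ball x0 r) = measure m (ball x0 1) * r powr N"
  show "volume_cone_at N m x0"
    unfolding volume_cone_at_def
  proof (intro allI impI)
    fix r R :: real assume r: "0 < r" "r < R"
    define V where "V = measure m (ball x0 1)"
    have "0 < V" unfolding V_def by (rule mms_ball(3)[OF m]) simp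
    moreover have "measure m (ball x0 r) = V * r powr N" "measure m (ball x0 R) = V * R powr N"
      unfolding V_def using r by (intro c[rule_format]; linarith)+
    ultimately show "measure m (ball x0 R) / measure m (ball x0 r) = (R / r) powr N"
      using r by (simp add: powr_divide)
  qed
qed

text \<open>
By the volume comparison the second Gaussian moment is at most \<open>N / 2\<close> times the mass; equality
characterises the cones.
\<close>

lemma volume_cone_at_iff_Gaussian:
  fixes m :: "'a::polish_space measure" and x0 :: 'a
  assumes m: "metric_measure_space m" and mcp: "MCP0 N m" and N: "0 \<le> N"
  defines "G0 \<equiv> LINT x|m. exp (- (dist x0 x)\<^sup>2)"
    and "G2 \<equiv> LINT x|m. (dist x0 x)\<^sup>2 * exp (- (dist x0 x)\<^sup>2)"
  shows "N / 2 * G0 \<le> G2 \<Longrightarrow> volume_cone_at N m x0"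
    and "volume_cone_at N m x0 \<Longrightarrow> G2 = N / 2 * G0"
proof -
  define v where "v r = measure m (ball x0 r)" for r
  interpret radial_volume N v
    unfolding v_def[abs_def] by (rule ball_radial_volume[OF m mcp N])
  have key: "G2 - N / 2 * G0 = (LINT r|lborel. cone_weight N r * v r)"
    unfolding G0_def G2_def v_def by (rule Gaussian_moments(3)[OF m mcp N])
  show "volume_cone_at N m x0" if "N / 2 * G0 \<le> G2"
  proof -
    have "0 \<le> (LINT r|lborel. cone_weight N r * v r)"
      using that key by simp
    note const = ratio_constant[OF this]
    have "v r = v 1 * r powr N" if "0 < r" for r
    proof -
      have "v r / r powr N = v 1 / 1 powr N"
        by (rule trans[OF const[OF that] const[symmetric]]) simp
      then show ?thesis using that by (simp add: divide_eq_eq)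
    qed
    then show ?thesis
      unfolding volume_cone_at_iff[OF m] v_def by (intro allI impI)
  qed
  show "G2 = N / 2 * G0" if "volume_cone_at N m x0"
  proof -
    have v: "v r = v 1 * (if r \<le> 0 then 0 else r powr N)" for r
    proof (cases "r \<le> 0")
      case False
      then show ?thesis
        using that[unfolded volume_cone_at_iff[OF m], rule_format, of r] by (simp add: v_def)
    qed (simp add: zero)
    have "cone_weight N r * v r = v 1 * (cone_weight N r * (if r \<le> 0 then 0 else r powr N))" for r
      by (subst v) (rule mult.left_commute)
    then have "(LINT r|lborel. cone_weight N r * v r)
        = (LINT r|lborel. v 1 * (cone_weight N r * (if r \<le> 0 then 0 else r powr N)))"
      by (simp only:)
    also have "\<dots> = 0"
      using integral_cone_weight_powr[OF N] by simp
    finally show ?thesis using key by simp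
  qed
qed

section \<open>The local Lipschitz constant and Gaussian test functions\<close>

lemma local_lip_le:
  assumes "\<And>e. L < e \<Longrightarrow> \<forall>\<^sub>F y in at x. \<bar>u y - u x\<bar> \<le> e * dist x y"
  shows "local_lip u x \<le> ennreal L"
proof (rule dense_ge)
  fix b :: ennreal assume b: "ennreal L < b"
  show "local_lip u x \<le> b"
  proof (cases b)
    case top then show ?thesis by simp
  next
    case (real e)
    then have "L < e" using b ennreal_leI[of e L] by (force simp flip: not_le)
    from assms[OF this] have "\<forall>\<^sub>F y in at x. ennreal (\<bar>u y - u x\<bar> / dist x y) \<le> b"
      using eventually_neq_at_within[of x x UNIV]
    proof eventually_elim
      case (elim y)
      then show ?case unfolding real by (intro ennreal_leI) (simp add: pos_divide_le_eq)
    qed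
    then show ?thesis unfolding local_lip_def by (rule Limsup_bounded)
  qed
qed

text \<open>
The upper limit is a countable infimum of suprema of the difference quotient over punctured balls of
radius \<open>1 / (n + 1)\<close>. Such a supremum is lower semicontinuous in the centre: a point that makes the
quotient large at \<open>x\<close> still does so, and stays in the punctured ball, when \<open>x\<close> moves a little.
\<close>

lemma measurable_local_lip [measurable]:
  fixes u :: "'a::polish_space \<Rightarrow> real"
  assumes u: "continuous_on UNIV u"
  shows "local_lip u \<in> borel_measurable borel"
proof -
  define q where "q x y = ennreal (\<bar>u y - u x\<bar> / dist x y)" for x y
  define S where "S n x = (SUP y\<in>{y. y \<noteq> x \<and> dist x y < 1 / Suc n}. q x y)" for n x
  have eq: "local_lip u x = (INF n. S n x)" for x
  proof (rule antisym)
    show "local_lip u x \<le> (INF n. S n x)"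
    proof (rule INF_greatest)
      fix n
      have "\<forall>\<^sub>F y in at x. y \<noteq> x \<and> dist x y < 1 / Suc n"
        unfolding eventually_at by (intro exI[of _ "1 / Suc n"]) (auto simp: dist_commute)
      then have "\<forall>\<^sub>F y in at x. q x y \<le> S n x"
        by eventually_elim (auto simp: S_def intro!: SUP_upper)
      then show "local_lip u x \<le> S n x"
        unfolding local_lip_def q_def[symmetric] by (rule Limsup_bounded)
    qed
    show "(INF n. S n x) \<le> local_lip u x"
      unfolding local_lip_def q_def[symmetric]
    proof (rule Limsup_greatest)
      fix P assume "\<forall>\<^sub>F y in at x. P y"
      then obtain d where d: "0 < d" "\<And>y. y \<noteq> x \<Longrightarrow> dist y x < d \<Longrightarrow> P y"
        unfolding eventually_at by auto
      obtain n where n: "1 / real (Suc n) < d" using nat_approx_posE[OF d(1)] .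
      have "(INF n. S n x) \<le> S n x" by (rule INF_lower) simp
      also have "\<dots> \<le> (SUP y\<in>Collect P. q x y)"
        unfolding S_def using n d by (intro SUP_subset_mono) (auto simp: dist_commute)
      finally show "(INF n. S n x) \<le> (SUP y\<in>Collect P. q x y)" .
    qed
  qed
  have "S n \<in> borel_measurable borel" for n
  proof (rule borel_measurableI_greater)
    fix c
    have "{x. c < S n x} = (\<Union>y. {x. y \<noteq> x \<and> dist x y < 1 / Suc n \<and> c < q x y})"
      unfolding S_def less_SUP_iff by auto
    moreover have "open {x. y \<noteq> x \<and> dist x y < 1 / Suc n \<and> c < q x y}" for y
    proof -
      have o: "open {x. y \<noteq> x \<and> dist x y < 1 / Suc n}"
        by (intro open_Collect_conj open_Collect_neq open_Collect_less continuous_intros)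
      have "continuous_on {x. y \<noteq> x \<and> dist x y < 1 / Suc n} (\<lambda>x. q x y)"
        unfolding q_def
        by (intro continuous_on_ennreal continuous_intros continuous_on_subset[OF u]) auto
      with o have "open ({x. y \<noteq> x \<and> dist x y < 1 / Suc n} \<inter> (\<lambda>x. q x y) -` {c<..})"
        by (intro continuous_open_preimage open_greaterThan)
      then show ?thesis by (simp add: vimage_def Int_def conj_ac)
    qed
    ultimately have "open {x. c < S n x}" by (auto simp: open_UN)
    then show "{x \<in> space borel. c < S n x} \<in> sets borel" by simp
  qed
  then show ?thesis
    unfolding eq[abs_def] by measurable
qed

lemma Gaussian_has_derivative:
  "((\<lambda>r::real. exp (- r\<^sup>2 / 2)) has_real_derivative - (r * exp (- r\<^sup>2 / 2))) (at r)"
  by (auto intro!: derivative_eq_intros)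

lemma Gaussian_Lipschitz:
  fixes r s :: real
  shows "\<bar>exp (- r\<^sup>2 / 2) - exp (- s\<^sup>2 / 2)\<bar> \<le> \<bar>r - s\<bar>"
proof -
  \<comment> \<open>\<open>\<bar>x\<bar> \<le> 1 + x\<^sup>2 / 2 \<le> exp (x\<^sup>2 / 2)\<close>\<close>
  have "norm (- (x * exp (- x\<^sup>2 / 2))) \<le> 1" for x :: real
  proof -
    have "0 \<le> (\<bar>x\<bar> - 1)\<^sup>2" by simp
    then have "\<bar>x\<bar> \<le> 1 + x\<^sup>2 / 2" by (simp add: power2_diff)
    also have "\<dots> \<le> exp (x\<^sup>2 / 2)" by (rule exp_ge_add_one_self)
    finally show ?thesis by (simp add: abs_mult exp_minus field_simps)
  qed
  from field_differentiable_bound[OF convex_UNIV has_field_derivative_at_within[OF Gaussian_has_derivative] this]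
  show ?thesis by simp
qed

text \<open>
Subtracting a constant before truncating at zero makes the support compact and leaves the
derivative of the Gaussian unchanged where the function is positive, so that the local Lipschitz
constant is bounded by that of the full Gaussian, without an error term.
\<close>

definition Gaussian_cutoff :: "nat \<Rightarrow> 'a::metric_space \<Rightarrow> 'a \<Rightarrow> real" where
  "Gaussian_cutoff k x0 x = max 0 (exp (- (dist x0 x)\<^sup>2 / 2) - exp (- (real k)\<^sup>2 / 2))"

lemma Gaussian_cutoff_diff:
  "\<bar>Gaussian_cutoff k x0 y - Gaussian_cutoff k x0 x\<bar>
    \<le> \<bar>exp (- (dist x0 y)\<^sup>2 / 2) - exp (- (dist x0 x)\<^sup>2 / 2)\<bar>"
  by (simp add: Gaussian_cutoff_def)

lemma dist_diff_le: "\<bar>dist x0 y - dist x0 x\<bar> \<le> dist x (y::'a::metric_space)"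
  using dist_triangle[of x0 y x] dist_triangle[of x0 x y] by (simp add: dist_commute)

lemma Gaussian_cutoff_in_Lip_c:
  fixes x0 :: "'a::metric_space"
  assumes "\<And>R. compact (cball x0 R)"
  shows "Gaussian_cutoff k x0 \<in> Lip_c"
proof -
  have "1-lipschitz_on UNIV (Gaussian_cutoff k x0)"
  proof (rule lipschitz_onI)
    fix x y
    have "\<bar>Gaussian_cutoff k x0 x - Gaussian_cutoff k x0 y\<bar> \<le> \<bar>dist x0 x - dist x0 y\<bar>"
      using Gaussian_cutoff_diff[of k x0 x y] Gaussian_Lipschitz[of "dist x0 x" "dist x0 y"] by linarith
    also have "\<dots> \<le> dist x y" using dist_diff_le[of x0 x y] by (simp add: dist_commute)
    finally show "dist (Gaussian_cutoff k x0 x) (Gaussian_cutoff k x0 y) \<le> 1 * dist x y"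
      by (simp add: dist_real_def)
  qed simp
  moreover have "closure {x. Gaussian_cutoff k x0 x \<noteq> 0} \<subseteq> cball x0 (real k)"
  proof (rule closure_minimal)
    show "{x. Gaussian_cutoff k x0 x \<noteq> 0} \<subseteq> cball x0 (real k)"
    proof
      fix x assume "x \<in> {x. Gaussian_cutoff k x0 x \<noteq> 0}"
      then show "x \<in> cball x0 (real k)"
        by (simp add: Gaussian_cutoff_def max_def split: if_splits)
    qed
  qed simp
  then have "compact (closure {x. Gaussian_cutoff k x0 x \<noteq> 0})"
    using compact_Int_closed[OF assms[of "real k"] closed_closure[of "{x. Gaussian_cutoff k x0 x \<noteq> 0}"]]
    by (simp add: Int_absorb1)
  ultimately show ?thesis by (auto simp: Lip_c_def)
qed

lemma local_lip_Gaussian_cutoff: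
  "local_lip (Gaussian_cutoff k x0) x \<le> ennreal (dist x0 x * exp (- (dist x0 x)\<^sup>2 / 2))"
proof (rule local_lip_le)
  fix e assume e: "dist x0 x * exp (- (dist x0 x)\<^sup>2 / 2) < e"
  define f where "f r = exp (- r\<^sup>2 / 2)" for r :: real
  define r where "r = dist x0 x"
  have "((\<lambda>s. (f s - f r) / (s - r)) \<longlongrightarrow> - (r * f r)) (at r)"
    using Gaussian_has_derivative[of r] unfolding f_def has_field_derivative_iff by simp
  then have "((\<lambda>s. \<bar>(f s - f r) / (s - r)\<bar>) \<longlongrightarrow> \<bar>- (r * f r)\<bar>) (at r)"
    by (rule tendsto_rabs)
  moreover have "\<bar>- (r * f r)\<bar> < e"
    using e by (simp add: r_def f_def abs_mult)
  ultimately have "\<forall>\<^sub>F s in at r. \<bar>(f s - f r) / (s - r)\<bar> < e"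
    by (rule order_tendstoD)
  then obtain d where d: "0 < d" "\<And>s. s \<noteq> r \<Longrightarrow> dist s r < d \<Longrightarrow> \<bar>(f s - f r) / (s - r)\<bar> < e"
    unfolding eventually_at by auto
  have "0 \<le> dist x0 x * exp (- (dist x0 x)\<^sup>2 / 2)" by simp
  then have e0: "0 \<le> e" using e by linarith
  have fe: "\<bar>f s - f r\<bar> \<le> e * \<bar>s - r\<bar>" if "\<bar>s - r\<bar> < d" for s
  proof (cases "s = r")
    case False
    then show ?thesis
      using d(2)[OF False] that by (simp add: dist_real_def abs_divide pos_divide_less_eq)
  qed simp
  have "\<forall>\<^sub>F y in at x. dist x y < d"
    unfolding eventually_at using d(1) by (auto simp: dist_commute)
  then show "\<forall>\<^sub>F y in at x. \<bar>Gaussian_cutoff k x0 y - Gaussian_cutoff k x0 x\<bar> \<le> e * dist x y"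
  proof eventually_elim
    case (elim y)
    have "\<bar>Gaussian_cutoff k x0 y - Gaussian_cutoff k x0 x\<bar> \<le> \<bar>f (dist x0 y) - f r\<bar>"
      using Gaussian_cutoff_diff[of k x0 y x] by (simp add: f_def r_def)
    also have "\<dots> \<le> e * \<bar>dist x0 y - r\<bar>"
      using dist_diff_le[of x0 y x] elim by (intro fe) (simp add: r_def)
    also have "\<dots> \<le> e * dist x y"
      using dist_diff_le[of x0 y x] e0 by (intro mult_left_mono) (simp_all add: r_def)
    finally show ?case .
  qed
qed

lemma exp_half_square:
  "(exp (- t\<^sup>2 / 2))\<^sup>2 = exp (- (t::real)\<^sup>2)" "(exp (- (t\<^sup>2 / 2)))\<^sup>2 = exp (- (t::real)\<^sup>2)"
  by (simp_all add: power2_eq_square mult_exp_exp)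

lemma Gaussian_cutoff_square_tendsto:
  "(\<lambda>k. (Gaussian_cutoff k x0 x)\<^sup>2) \<longlonglongrightarrow> exp (- (dist x0 x)\<^sup>2)"
proof -
  have 0: "(\<lambda>k::nat. exp (- (real k)\<^sup>2 / 2)) \<longlonglongrightarrow> 0"
  proof (rule Lim_null_comparison)
    show "\<forall>\<^sub>F k in sequentially. norm (exp (- (real k)\<^sup>2 / 2)) \<le> inverse (real (Suc k)) * 2"
    proof (rule always_eventually, rule allI)
      fix k :: nat
      have "0 \<le> (real k - 1)\<^sup>2" by simp
      then have "(1 + real k) / 2 \<le> 1 + (real k)\<^sup>2 / 2" by (simp add: power2_diff) 
      also have "\<dots> \<le> exp ((real k)\<^sup>2 / 2)" by (rule exp_ge_add_one_self)
      finally show "norm (exp (- (real k)\<^sup>2 / 2)) \<le> inverse (real (Suc k)) * 2"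
        by (simp add: exp_minus field_simps)
    qed
    show "(\<lambda>k. inverse (real (Suc k)) * 2) \<longlonglongrightarrow> 0"
      using tendsto_mult_left_zero[OF LIMSEQ_inverse_real_of_nat] by blast
  qed
  have "(\<lambda>k. (Gaussian_cutoff k x0 x)\<^sup>2) \<longlonglongrightarrow> (max 0 (exp (- (dist x0 x)\<^sup>2 / 2) - 0))\<^sup>2"
    unfolding Gaussian_cutoff_def by (intro tendsto_intros 0)
  then show ?thesis by (simp add: exp_half_square)
qed

lemma Gaussian_cutoff_square_le: "(Gaussian_cutoff k x0 x)\<^sup>2 \<le> exp (- (dist x0 x)\<^sup>2)"
  unfolding exp_half_square(1)[symmetric] by (rule power_mono) (auto simp: Gaussian_cutoff_def)

text \<open>
For the Gaussian \<open>exp (- d\<^sup>2 / 2)\<close> the energy and the second moment are both bounded by the integral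
of \<open>d\<^sup>2 * exp (- d\<^sup>2)\<close>. The cutoffs satisfy the same two bounds, so the limit has to be taken only in
the integral of the square.
\<close>

lemma uncertainty_inequality_Gaussian:
  fixes m :: "'a::polish_space measure"
  assumes m: "metric_measure_space m" and mcp: "MCP0 N m" and N: "0 \<le> N"
    and ineq: "uncertainty_inequality m x0 C" and C: "0 \<le> C"
  shows "C * (LINT x|m. exp (- (dist x0 x)\<^sup>2))\<^sup>2
    \<le> (LINT x|m. (dist x0 x)\<^sup>2 * exp (- (dist x0 x)\<^sup>2))\<^sup>2"
proof -
  define G0 where "G0 = (LINT x|m. exp (- (dist x0 x)\<^sup>2))"
  define G2 where "G2 = (LINT x|m. (dist x0 x)\<^sup>2 * exp (- (dist x0 x)\<^sup>2))"
  note int = Gaussian_moments(1,2)[OF m mcp N, of x0]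
  note s[measurable_cong] = mms_sets[OF m]
  have [measurable]: "Gaussian_cutoff k x0 \<in> borel_measurable borel" for k
    unfolding Gaussian_cutoff_def[abs_def] by measurable
  have G2: "(\<integral>\<^sup>+ x. ennreal ((dist x0 x)\<^sup>2 * exp (- (dist x0 x)\<^sup>2)) \<partial>m) = ennreal G2"
    unfolding G2_def using int by (intro nn_integral_eq_integral) auto
  have G2_pos: "0 \<le> G2" unfolding G2_def by (rule Bochner_Integration.integral_nonneg) simp
  define I where "I k = (LINT x|m. (Gaussian_cutoff k x0 x)\<^sup>2)" for k
  have I_int: "integrable m (\<lambda>x. (Gaussian_cutoff k x0 x)\<^sup>2)" for k
    by (rule Bochner_Integration.integrable_bound[OF int(1)])
      (auto simp: Gaussian_cutoff_square_le)
  have I_pos: "0 \<le> I k" for k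
    unfolding I_def by (rule Bochner_Integration.integral_nonneg) simp
  have "C * (I k)\<^sup>2 \<le> G2\<^sup>2" for k
  proof -
    let ?u = "Gaussian_cutoff k x0"
    have "?u \<in> Lip_c"
      by (rule Gaussian_cutoff_in_Lip_c) (rule compact_cball_of_MCP0[OF m mcp])
    then have "ennreal C * (\<integral>\<^sup>+ x. ennreal ((?u x)\<^sup>2) \<partial>m)\<^sup>2
      \<le> (\<integral>\<^sup>+ x. (local_lip ?u x)\<^sup>2 \<partial>m) * (\<integral>\<^sup>+ x. ennreal ((dist x0 x)\<^sup>2 * (?u x)\<^sup>2) \<partial>m)"
      using ineq by (simp add: uncertainty_inequality_def)
    also have "\<dots> \<le> ennreal G2 * ennreal G2"
      unfolding G2[symmetric]
    proof (intro mult_mono nn_integral_mono)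
      fix x
      have "(local_lip ?u x)\<^sup>2 \<le> (ennreal (dist x0 x * exp (- (dist x0 x)\<^sup>2 / 2)))\<^sup>2"
        by (rule power_mono[OF local_lip_Gaussian_cutoff]) simp
      also have "\<dots> = ennreal ((dist x0 x)\<^sup>2 * exp (- (dist x0 x)\<^sup>2))"
        by (simp add: ennreal_power power_mult_distrib exp_half_square)
      finally show "(local_lip ?u x)\<^sup>2 \<le> ennreal ((dist x0 x)\<^sup>2 * exp (- (dist x0 x)\<^sup>2))" .
      show "ennreal ((dist x0 x)\<^sup>2 * (?u x)\<^sup>2) \<le> ennreal ((dist x0 x)\<^sup>2 * exp (- (dist x0 x)\<^sup>2))"
        by (intro ennreal_leI mult_left_mono Gaussian_cutoff_square_le) simp
    qed simp_all
    also have "(\<integral>\<^sup>+ x. ennreal ((?u x)\<^sup>2) \<partial>m) = ennreal (I k)"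
      unfolding I_def using I_int by (intro nn_integral_eq_integral) auto
    finally have "ennreal (C * (I k)\<^sup>2) \<le> ennreal (G2\<^sup>2)"
      using C I_pos G2_pos by (simp add: ennreal_power ennreal_mult power2_eq_square)
    then show ?thesis by (simp add: ennreal_le_iff)
  qed
  moreover have "I \<longlonglongrightarrow> G0"
    unfolding I_def[abs_def] G0_def
  proof (rule integral_dominated_convergence[OF _ _ int(1)])
    show "AE x in m. (\<lambda>k. (Gaussian_cutoff k x0 x)\<^sup>2) \<longlonglongrightarrow> exp (- (dist x0 x)\<^sup>2)"
      by (intro AE_I2 Gaussian_cutoff_square_tendsto)
  qed (auto simp: Gaussian_cutoff_square_le)
  then have "(\<lambda>k. C * (I k)\<^sup>2) \<longlonglongrightarrow> C * G0\<^sup>2" by (intro tendsto_intros)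
  ultimately show ?thesis
    unfolding G0_def[symmetric] G2_def[symmetric] by (intro LIMSEQ_le_const2) auto
qed

section \<open>Rigidity and sharpness\<close>

text \<open>
Tested on the Gaussian, the inequality says that the second moment is at least \<open>N / 2\<close> times the
mass, which is the extremal case of the volume comparison.
\<close>

lemma volume_cone_of_uncertainty:
  fixes m :: "'a::polish_space measure"
  assumes m: "metric_measure_space m" and mcp: "MCP0 N m" and N: "0 \<le> N"
    and ineq: "uncertainty_inequality m x0 (N\<^sup>2 / 4)"
  shows "volume_cone_at N m x0"
proof (rule volume_cone_at_iff_Gaussian(1)[OF m mcp N])
  let ?G0 = "LINT x|m. exp (- (dist x0 x)\<^sup>2)"
  let ?G2 = "LINT x|m. (dist x0 x)\<^sup>2 * exp (- (dist x0 x)\<^sup>2)"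
  have "(N / 2 * ?G0)\<^sup>2 \<le> ?G2\<^sup>2"
    using uncertainty_inequality_Gaussian[OF m mcp N ineq]
    by (simp add: power_mult_distrib power_divide)
  moreover have "0 \<le> ?G2" by (rule Bochner_Integration.integral_nonneg) simp
  ultimately show "N / 2 * ?G0 \<le> ?G2" by (rule power2_le_imp_le)
qed

text \<open>
In a cone the second Gaussian moment is exactly \<open>N / 2\<close> times the mass, so the Gaussian does not
allow a constant above \<open>N\<^sup>2 / 4\<close>.
\<close>

lemma uncertainty_constant_le:
  fixes m :: "'a::polish_space measure"
  assumes m: "metric_measure_space m" and mcp: "MCP0 N m" and N: "0 \<le> N"
    and cone: "volume_cone_at N m x0" and ineq: "uncertainty_inequality m x0 C"
  shows "C \<le> N\<^sup>2 / 4"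
proof (cases "0 \<le> C")
  case True
  define G0 where "G0 = (LINT x|m. exp (- (dist x0 x)\<^sup>2))"
  have pos: "0 < G0\<^sup>2"
    using Gaussian_mass_pos[OF m Gaussian_moments(1)[OF m mcp N, of x0]] by (simp add: G0_def)
  have "C * G0\<^sup>2 \<le> (N / 2 * G0)\<^sup>2"
    using uncertainty_inequality_Gaussian[OF m mcp N ineq True]
    unfolding volume_cone_at_iff_Gaussian(2)[OF m mcp N cone] G0_def .
  also have "\<dots> = N\<^sup>2 / 4 * G0\<^sup>2"
    by (simp add: power_mult_distrib power_divide)
  finally show ?thesis
    using pos by (rule mult_right_le_imp_le)
next
  case False
  then have "C \<le> 0" by simp
  also have "0 \<le> N\<^sup>2 / 4" by simp
  finally show ?thesis .
qed

section \<open>Contraction in a volume cone\<close>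

text \<open>
Neither measure has mass to spare: an inequality on a set turns into the reverse one on its
complement.
\<close>

lemma prob_measure_eqI_le:
  assumes "prob_space P" "prob_space Q" and sets: "sets P = sets Q"
    and le: "\<And>A. A \<in> sets Q \<Longrightarrow> emeasure P A \<le> emeasure Q A"
  shows "P = Q"
proof (rule measure_eqI[OF sets])
  interpret P: prob_space P by fact
  interpret Q: prob_space Q by fact
  fix A assume A: "A \<in> sets P"
  have sp: "space P = space Q" by (rule sets_eq_imp_space_eq[OF sets])
  have le': "measure P B \<le> measure Q B" if "B \<in> sets P" for B
    using le[of B] that sets by (simp add: P.emeasure_eq_measure Q.emeasure_eq_measure)
  have "measure P (space P - A) \<le> measure Q (space Q - A)"
    using le'[OF sets.compl_sets[OF A]] by (simp add: sp)
  then have "measure Q A \<le> measure P A"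
    using P.prob_compl[OF A] Q.prob_compl[of A] A sets by simp
  with le'[OF A] show "emeasure P A = emeasure Q A"
    by (simp add: P.emeasure_eq_measure Q.emeasure_eq_measure)
qed

text \<open>
At time \<open>t\<close> the whole mass lies in the ball of radius \<open>(1 - t) * R\<close>, and \<open>MCP0\<close> bounds its
distribution there from above by \<open>m\<close>, divided by \<open>(1 - t) powr N\<close> times the volume of the large
ball. In a cone this divisor is the volume of the small ball, so the bound is a probability measure
too and is attained.
\<close>

lemma volume_cone_pushforward:
  fixes m :: "'a::polish_space measure"
  assumes m: "metric_measure_space m" and cone: "volume_cone_at N m x0"
    and plan: "contraction_plan N m x0 R \<nu>" and t: "0 \<le> t" "t < 1" and R: "0 < R"
  shows "distr \<nu> borel (\<lambda>\<gamma>. apply_bcontfun \<gamma> t) = uniform_measure m (ball x0 ((1 - t) * R))"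
proof (rule prob_measure_eqI_le)
  define S where "S = ball x0 ((1 - t) * R)"
  define D where "D = distr \<nu> borel (\<lambda>\<gamma>. apply_bcontfun \<gamma> t)"
  interpret prob_space \<nu> using plan by (simp add: contraction_plan_def)
  note ev = contraction_plan_measurable[OF plan]
  note s = mms_sets[OF m]
  have R': "0 < (1 - t) * R" using t R by simp
  note bS = mms_ball[OF m R', of x0, folded S_def] and bR = mms_ball[OF m R, of x0]
  show D: "prob_space (distr \<nu> borel (\<lambda>\<gamma>. apply_bcontfun \<gamma> t))"
    by (rule prob_space_distr[OF ev])
  show "prob_space (uniform_measure m (ball x0 ((1 - t) * R)))"
    unfolding S_def[symmetric] using bS by (intro prob_space_uniform_measure) auto
  show "sets (distr \<nu> borel (\<lambda>\<gamma>. apply_bcontfun \<gamma> t)) = sets (uniform_measure m (ball x0 ((1 - t) * R)))"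
    using s by simp
  have vol: "measure m S = (1 - t) powr N * measure m (ball x0 R)"
  proof -
    have "measure m S = measure m (ball x0 1) * ((1 - t) * R) powr N"
      "measure m (ball x0 R) = measure m (ball x0 1) * R powr N"
      unfolding S_def using cone[unfolded volume_cone_at_iff[OF m], rule_format] R R' by blast+
    then show ?thesis using t R by (simp only: powr_mult) simp
  qed
  fix A assume "A \<in> sets (uniform_measure m (ball x0 ((1 - t) * R)))"
  then have A: "A \<in> sets borel" using s by simp
  have "AE \<gamma> in \<nu>. \<gamma> \<in> Geo \<and> apply_bcontfun \<gamma> 1 = x0 \<and> dist x0 (apply_bcontfun \<gamma> 0) < R"
    using plan by (simp add: contraction_plan_def)
  then have "AE \<gamma> in \<nu>. apply_bcontfun \<gamma> t \<in> S"
  proof eventually_elim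
    case (elim \<gamma>)
    then show ?case
      using Geo_dist_endpoint[of \<gamma> x0 t] t by (simp add: S_def mult_strict_left_mono)
  qed
  then have "AE x in D. x \<in> S"
    unfolding D_def by (subst AE_distr_iff) (use ev in \<open>auto simp: S_def\<close>)
  then have "emeasure D A = emeasure D (S \<inter> A)"
    by (intro emeasure_eq_AE) (auto simp: D_def S_def A)
  moreover have "ennreal ((1 - t) powr N) * emeasure D (S \<inter> A) \<le> emeasure m (S \<inter> A) / emeasure m (ball x0 R)"
    using plan t A unfolding contraction_plan_def D_def S_def by auto
  moreover have "emeasure D (S \<inter> A) = ennreal (measure D (S \<inter> A))"
    using D unfolding D_def by (intro finite_measure.emeasure_eq_measure prob_space.finite_measure)
  moreover have "emeasure m (S \<inter> A) = ennreal (measure m (S \<inter> A))"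
    using emeasure_mono[of "S \<inter> A" S m] bS s A
    by (intro emeasure_eq_ennreal_measure) (auto simp: S_def top_unique)
  ultimately have "(1 - t) powr N * measure D (S \<inter> A) \<le> measure m (S \<inter> A) / measure m (ball x0 R)"
    and DA: "emeasure D A = ennreal (measure D (S \<inter> A))"
    and mA: "emeasure m (S \<inter> A) = ennreal (measure m (S \<inter> A))"
    using bR by (auto simp: divide_ennreal simp flip: ennreal_mult)
  then have "measure D (S \<inter> A) \<le> measure m (S \<inter> A) / measure m S"
    using t bR(3) unfolding vol by (simp add: field_simps)
  then show "emeasure (distr \<nu> borel (\<lambda>\<gamma>. apply_bcontfun \<gamma> t)) A
      \<le> emeasure (uniform_measure m (ball x0 ((1 - t) * R))) A"
    unfolding D_def[symmetric] S_def[symmetric] DA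
    using A s bS by (simp only: emeasure_uniform_measure[of S m A] borel_open S_def open_ball)
      (simp add: mA[unfolded S_def] divide_ennreal ennreal_leI)
qed

lemma limsup_difference_quotient_le:
  fixes u :: "'a::metric_space \<Rightarrow> real"
  assumes y: "y \<longlonglongrightarrow> x" "\<And>n. y n \<noteq> x"
  shows "limsup (\<lambda>n. ennreal (\<bar>u (y n) - u x\<bar> / dist x (y n))) \<le> local_lip u x"
proof -
  have "filterlim y (at x) sequentially"
    using y by (auto simp: filterlim_at)
  then have "filtermap y sequentially \<le> at x"
    by (simp add: filterlim_def)
  then have "Limsup (filtermap y sequentially) (\<lambda>z. ennreal (\<bar>u z - u x\<bar> / dist x z)) \<le> local_lip u x"
    unfolding local_lip_def Limsup_def by (intro INF_superset_mono) (auto dest: filter_leD)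
  with Limsup_filtermap_ge show ?thesis by (rule order_trans)
qed

text \<open>
The speed of the geodesic is the distance between its endpoints, so the difference quotient in time
is this speed times the difference quotient in space.
\<close>

lemma limsup_along_geodesic:
  fixes u :: "'a::metric_space \<Rightarrow> real"
  assumes \<gamma>: "\<gamma> \<in> Geo" and \<tau>: "\<And>n. 0 < \<tau> n" "\<And>n. \<tau> n \<le> 1" "\<tau> \<longlonglongrightarrow> 0" and c: "0 \<le> c"
  defines "x \<equiv> apply_bcontfun \<gamma> 0"
  shows "limsup (\<lambda>n. ennreal (c * \<bar>u (apply_bcontfun \<gamma> (\<tau> n)) - u x\<bar> / \<tau> n))
    \<le> ennreal (c * dist x (apply_bcontfun \<gamma> 1)) * local_lip u x"
proof -
  define y where "y n = apply_bcontfun \<gamma> (\<tau> n)" for n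
  define D where "D = dist x (apply_bcontfun \<gamma> 1)"
  have d: "dist x (y n) = \<tau> n * D" for n
    using Geo_dist_startpoint[OF \<gamma>, of "\<tau> n"] \<tau>(1,2)[of n] by (simp add: x_def y_def D_def)
  show ?thesis
  proof (cases "D = 0")
    case True
    then have "y n = x" for n using d[of n] by simp
    then show ?thesis by (simp add: y_def[symmetric] Limsup_const)
  next
    case False
    then have D: "0 < D" by (simp add: D_def)
    have "(\<lambda>n. dist x (y n)) \<longlonglongrightarrow> 0"
      unfolding d using tendsto_mult_left_zero[OF \<tau>(3)] by simp
    then have lim: "y \<longlonglongrightarrow> x"
      by (subst tendsto_dist_iff) (simp add: dist_commute)
    have ne: "y n \<noteq> x" for n using d[of n] D \<tau>(1)[of n] by auto
    define q where "q n = ennreal (\<bar>u (y n) - u x\<bar> / dist x (y n))" for n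
    have "limsup (\<lambda>n. ennreal (c * \<bar>u (y n) - u x\<bar> / \<tau> n)) = limsup (\<lambda>n. ennreal (c * D) * q n)"
    proof (rule arg_cong[where f = limsup], rule ext)
      fix n
      have "c * \<bar>u (y n) - u x\<bar> / \<tau> n = (c * D) * (\<bar>u (y n) - u x\<bar> / dist x (y n))"
        using D \<tau>(1)[of n] by (simp add: d)
      then show "ennreal (c * \<bar>u (y n) - u x\<bar> / \<tau> n) = ennreal (c * D) * q n"
        unfolding q_def using c D by (simp only:) (rule ennreal_mult; simp)
    qed
    also have "\<dots> = ennreal (c * D) * limsup q"
    proof (rule Limsup_compose_continuous_mono[where f = "\<lambda>b. ennreal (c * D) * b"])
      show "continuous_on UNIV (\<lambda>b. ennreal (c * D) * b)"
        unfolding continuous_on_def by (auto intro!: ennreal_tendsto_cmult tendsto_ident_at)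
    qed (auto simp: mono_def intro: mult_left_mono)
    also have "\<dots> \<le> ennreal (c * D) * local_lip u x"
      unfolding q_def by (intro mult_left_mono limsup_difference_quotient_le[OF lim ne]) simp
    finally show ?thesis unfolding y_def D_def .
  qed
qed

lemma powr_minus_ge:
  fixes t N :: real
  assumes "0 \<le> t" "t < 1" "0 \<le> N"
  shows "1 + N * t \<le> 1 / (1 - t) powr N"
proof -
  have "ln (1 - t) \<le> - t" using ln_le_minus_one[of "1 - t"] assms by simp
  then have "N * t \<le> - (N * ln (1 - t))"
    using mult_left_mono[of t "- ln (1 - t)" N] assms by simp
  have "1 + N * t \<le> exp (N * t)" by (rule exp_ge_add_one_self)
  also have "\<dots> \<le> exp (- (N * ln (1 - t)))" using \<open>N * t \<le> _\<close> by simp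
  also have "\<dots> = 1 / (1 - t) powr N"
    using assms by (simp add: powr_def exp_minus inverse_eq_divide)
  finally show ?thesis .
qed

section \<open>The uncertainty inequality in a volume cone\<close>

lemma square_diff_le:
  fixes a b :: real
  shows "\<bar>b\<^sup>2 - a\<^sup>2\<bar> \<le> 2 * \<bar>a\<bar> * \<bar>b - a\<bar> + (b - a)\<^sup>2"
proof -
  have "b\<^sup>2 - a\<^sup>2 = 2 * a * (b - a) + (b - a)\<^sup>2" by (simp add: power2_eq_square algebra_simps)
  then have "\<bar>b\<^sup>2 - a\<^sup>2\<bar> \<le> \<bar>2 * a * (b - a)\<bar> + \<bar>(b - a)\<^sup>2\<bar>" by (metis abs_triangle_ineq)
  then show ?thesis by (simp add: abs_mult)
qed

text \<open>
An integrated form of \<open>div (x - x0) = N\<close> for the square of \<open>u\<close>. Contract a ball containing the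
support of \<open>u\<close> well inside. By the formula for the transported measure, the mean of \<open>u\<^sup>2\<close> along the
plan at time \<open>t\<close> is \<open>J / (1 - t) powr N\<close>, hence grows at least at the rate \<open>J * N\<close>. Geodesic by
geodesic, the rate of change of \<open>u\<^sup>2\<close> at time \<open>0\<close> is at most \<open>2 \<bar>u\<bar> lip u\<close> times the speed, which is
the distance to \<open>x0\<close>. Fatou's lemma for upper limits compares the two, since the difference
quotients of the Lipschitz function \<open>u\<close> are uniformly bounded.
\<close>

lemma volume_cone_divergence:
  fixes m :: "'a::polish_space measure"
  assumes m: "metric_measure_space m" and mcp: "MCP0 N m" and N: "0 \<le> N"
    and cone: "volume_cone_at N m x0"
    and lip: "L-lipschitz_on UNIV u" and supp: "\<And>x. u x \<noteq> 0 \<Longrightarrow> dist x0 x < \<rho>" and \<rho>: "0 < \<rho>"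
  shows "ennreal N * (\<integral>\<^sup>+ x. ennreal ((u x)\<^sup>2) \<partial>m)
    \<le> (\<integral>\<^sup>+ x. ennreal (2 * \<bar>u x\<bar> * dist x0 x) * local_lip u x \<partial>m)"
proof -
  \<comment> \<open>The contracted ball still contains the support of \<open>u\<close> for all times up to \<open>1 / 2\<close>.\<close>
  define R where "R = 2 * \<rho>"
  have R: "0 < R" using \<rho> by (simp add: R_def)
  obtain \<nu> where plan: "contraction_plan N m x0 R \<nu>"
    using ex_contraction_plan[OF m mcp R] by blast
  interpret prob_space \<nu> using plan by (simp add: contraction_plan_def)
  note s[measurable_cong] = mms_sets[OF m]
  note ev[measurable] = contraction_plan_measurable[OF plan]
  have L: "0 \<le> L" using lip by (rule lipschitz_on_nonneg)
  have cont: "continuous_on UNIV u" by (rule lipschitz_on_continuous_on[OF lip])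
  have [measurable]: "u \<in> borel_measurable borel" by (rule borel_measurable_continuous_onI[OF cont])
  have [measurable]: "local_lip u \<in> borel_measurable borel" by (rule measurable_local_lip[OF cont])
  define M where "M = \<bar>u x0\<bar> + L * \<rho>"
  have uL: "\<bar>u y - u x\<bar> \<le> L * dist x y" for x y
    using lipschitz_onD[OF lip, of y x] by (simp add: dist_real_def dist_commute)
  have M: "\<bar>u x\<bar> \<le> M" for x
  proof (cases "u x = 0")
    case True then show ?thesis using L \<rho> by (simp add: M_def)
  next
    case False
    have "\<bar>u x - u x0\<bar> \<le> L * dist x0 x" by (rule uL)
    also have "\<dots> \<le> L * \<rho>" using supp[OF False] L by (intro mult_left_mono) auto
    finally show ?thesis by (simp add: M_def)
  qed
  have M0: "0 \<le> M" using M[of x0] by simp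
  have u2: "(u x)\<^sup>2 \<le> M\<^sup>2" for x
    using power_mono[OF M[of x], of 2] by simp
  note mR = mms_ball[OF m R, of x0]
  define mu where "mu = measure m (ball x0 R)"
  have mu: "0 < mu" "emeasure m (ball x0 R) = ennreal mu" using mR by (simp_all add: mu_def)
  define J where "J = (LINT \<gamma>|\<nu>. (u (apply_bcontfun \<gamma> 0))\<^sup>2)"
  define I where "I = (\<integral>\<^sup>+ x. ennreal ((u x)\<^sup>2) \<partial>m)"
  have sq_int: "integrable \<nu> (\<lambda>\<gamma>. (u (apply_bcontfun \<gamma> t))\<^sup>2)" for t
    by (rule integrable_const_bound[of _ "M\<^sup>2"]) (use u2 in auto)
  have push: "ennreal (LINT \<gamma>|\<nu>. (u (apply_bcontfun \<gamma> t))\<^sup>2) = I / emeasure m (ball x0 ((1 - t) * R))"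
    if t: "0 \<le> t" "t \<le> 1 / 2" for t
  proof -
    have "\<rho> \<le> (1 - t) * R" using mult_right_mono[of "1 / 2" "1 - t" R] t R by (simp add: R_def)
    then have ball: "x \<in> ball x0 ((1 - t) * R)" if "u x \<noteq> 0" for x using supp[OF that] by simp
    have "ennreal (LINT \<gamma>|\<nu>. (u (apply_bcontfun \<gamma> t))\<^sup>2) = (\<integral>\<^sup>+ \<gamma>. ennreal ((u (apply_bcontfun \<gamma> t))\<^sup>2) \<partial>\<nu>)"
      using sq_int by (intro nn_integral_eq_integral[symmetric]) auto
    also have "\<dots> = (\<integral>\<^sup>+ x. ennreal ((u x)\<^sup>2) \<partial>distr \<nu> borel (\<lambda>\<gamma>. apply_bcontfun \<gamma> t))"
      by (subst nn_integral_distr) auto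
    also have "distr \<nu> borel (\<lambda>\<gamma>. apply_bcontfun \<gamma> t) = uniform_measure m (ball x0 ((1 - t) * R))"
      using t by (intro volume_cone_pushforward[OF m cone plan _ _ R]) auto
    also have "(\<integral>\<^sup>+ x. ennreal ((u x)\<^sup>2) \<partial>uniform_measure m (ball x0 ((1 - t) * R)))
        = (\<integral>\<^sup>+ x. ennreal ((u x)\<^sup>2) * indicator (ball x0 ((1 - t) * R)) x \<partial>m) / emeasure m (ball x0 ((1 - t) * R))"
      by (rule nn_integral_uniform_measure) (auto simp: s)
    also have "(\<integral>\<^sup>+ x. ennreal ((u x)\<^sup>2) * indicator (ball x0 ((1 - t) * R)) x \<partial>m) = I"
      unfolding I_def
    proof (rule nn_integral_cong)
      fix x
      show "ennreal ((u x)\<^sup>2) * indicator (ball x0 ((1 - t) * R)) x = ennreal ((u x)\<^sup>2)"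
        using ball[of x] by (cases "u x = 0") auto
    qed
    finally show ?thesis .
  qed
  have J0: "0 \<le> J" unfolding J_def by (rule Bochner_Integration.integral_nonneg) simp
  have "ennreal J = I / ennreal mu"
    using push[of 0] unfolding J_def by (simp add: mu)
  then have I_eq: "I = ennreal (J * mu)"
  proof (cases I)
    case (real i)
    then have "ennreal J = ennreal (i / mu)"
      using \<open>ennreal J = I / ennreal mu\<close> mu(1) by (simp add: divide_ennreal)
    then have "J = i / mu" using J0 real mu(1) by (subst (asm) ennreal_inj) auto
    then show ?thesis using real mu(1) by simp
  next
    case top
    then have "ennreal J = top" using \<open>ennreal J = I / ennreal mu\<close> by (simp add: ennreal_top_divide)
    then show ?thesis by simp
  qed
  have push': "(LINT \<gamma>|\<nu>. (u (apply_bcontfun \<gamma> t))\<^sup>2) = J / (1 - t) powr N"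
    if t: "0 \<le> t" "t \<le> 1 / 2" for t
  proof -
    have R': "0 < (1 - t) * R" using t R by simp
    have "measure m (ball x0 ((1 - t) * R)) = measure m (ball x0 1) * ((1 - t) * R) powr N"
      "mu = measure m (ball x0 1) * R powr N"
      unfolding mu_def using cone[unfolded volume_cone_at_iff[OF m], rule_format] R R' by blast+
    then have vol: "measure m (ball x0 ((1 - t) * R)) = (1 - t) powr N * mu"
      using t R by (simp only: powr_mult) simp
    have "ennreal (LINT \<gamma>|\<nu>. (u (apply_bcontfun \<gamma> t))\<^sup>2) = ennreal (J * mu) / ennreal ((1 - t) powr N * mu)"
      using push[OF t] mms_ball(4)[OF m R', of x0] by (simp only: I_eq vol)
    also have "\<dots> = ennreal (J * mu / ((1 - t) powr N * mu))"
      using J0 mu t by (intro divide_ennreal) auto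
    also have "J * mu / ((1 - t) powr N * mu) = J / (1 - t) powr N"
      using mu by simp
    finally show ?thesis
      using J0 by (subst (asm) ennreal_inj) (auto intro!: Bochner_Integration.integral_nonneg)
  qed
  define \<tau> where "\<tau> n = 1 / real (n + 2)" for n :: nat
  have \<tau>: "0 < \<tau> n" "\<tau> n \<le> 1 / 2" "\<tau> n \<le> 1" for n by (auto simp: \<tau>_def field_simps)
  have \<tau>_lim: "\<tau> \<longlonglongrightarrow> 0"
    using LIMSEQ_ignore_initial_segment[OF lim_1_over_n, of 2] by (simp add: \<tau>_def[abs_def])
  define f where "f n \<gamma> = 2 * \<bar>u (apply_bcontfun \<gamma> 0)\<bar>
      * \<bar>u (apply_bcontfun \<gamma> (\<tau> n)) - u (apply_bcontfun \<gamma> 0)\<bar> / \<tau> n" for n and \<gamma> :: "real \<Rightarrow>\<^sub>C 'a"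
  have f_meas [measurable]: "f n \<in> borel_measurable \<nu>" for n
    unfolding f_def by measurable
  have f0: "0 \<le> f n \<gamma>" for n \<gamma> using \<tau>[of n] by (simp add: f_def)
  have geo: "AE \<gamma> in \<nu>. \<gamma> \<in> Geo \<and> apply_bcontfun \<gamma> 1 = x0 \<and> dist x0 (apply_bcontfun \<gamma> 0) < R"
    using plan by (simp add: contraction_plan_def)
  have small: "AE \<gamma> in \<nu>. \<bar>u (apply_bcontfun \<gamma> (\<tau> n)) - u (apply_bcontfun \<gamma> 0)\<bar> \<le> L * R * \<tau> n" for n
    using geo
  proof eventually_elim
    case (elim \<gamma>)
    have "dist (apply_bcontfun \<gamma> 0) (apply_bcontfun \<gamma> (\<tau> n))
       = \<tau> n * dist (apply_bcontfun \<gamma> 0) (apply_bcontfun \<gamma> 1)"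
      using elim \<tau>[of n] by (intro Geo_dist_startpoint) auto
    also have "\<dots> \<le> \<tau> n * R"
      using elim \<tau>[of n] by (simp add: dist_commute mult_left_mono)
    finally have "L * dist (apply_bcontfun \<gamma> 0) (apply_bcontfun \<gamma> (\<tau> n)) \<le> L * (\<tau> n * R)"
      using L by (rule mult_left_mono)
    with uL[of "apply_bcontfun \<gamma> (\<tau> n)" "apply_bcontfun \<gamma> 0"] show ?case
      by (simp add: mult_ac)
  qed
  define W where "W = 2 * M * (L * R)"
  have fW: "AE \<gamma> in \<nu>. f n \<gamma> \<le> W" for n
    using small[of n]
  proof eventually_elim
    case (elim \<gamma>)
    have "f n \<gamma> \<le> 2 * M * (L * R * \<tau> n) / \<tau> n"
      unfolding f_def using elim M[of "apply_bcontfun \<gamma> 0"] \<tau>[of n] M0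
      by (intro divide_right_mono mult_mono) auto
    then show ?case using \<tau>[of n] by (simp add: W_def)
  qed
  have f_int: "integrable \<nu> (f n)" for n
    by (rule integrable_const_bound[of _ W]) (use fW[of n] f0 in auto)
  \<comment> \<open>\<open>c * \<tau> n\<close> bounds the quadratic error when the quotient of \<open>u\<^sup>2\<close> is replaced by that of \<open>u\<close>.\<close>
  define c where "c = (L * R)\<^sup>2"
  have main: "ennreal (J * N - c * \<tau> n) \<le> (\<integral>\<^sup>+ \<gamma>. ennreal (f n \<gamma>) \<partial>\<nu>)" for n
  proof -
    have "J * N \<le> (J / (1 - \<tau> n) powr N - J) / \<tau> n"
    proof -
      have "J * (1 + N * \<tau> n) \<le> J * (1 / (1 - \<tau> n) powr N)"
        using J0 N \<tau>[of n] by (intro mult_left_mono powr_minus_ge) auto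
      then show ?thesis using \<tau>[of n] by (simp add: pos_le_divide_eq algebra_simps)
    qed
    also have "\<dots> = (LINT \<gamma>|\<nu>. ((u (apply_bcontfun \<gamma> (\<tau> n)))\<^sup>2 - (u (apply_bcontfun \<gamma> 0))\<^sup>2) / \<tau> n)"
      using push'[of "\<tau> n"] \<tau>[of n] sq_int by (simp add: J_def)
    also have "\<dots> \<le> (LINT \<gamma>|\<nu>. f n \<gamma> + c * \<tau> n)"
    proof (rule integral_mono_AE)
      show "AE \<gamma> in \<nu>. ((u (apply_bcontfun \<gamma> (\<tau> n)))\<^sup>2 - (u (apply_bcontfun \<gamma> 0))\<^sup>2) / \<tau> n \<le> f n \<gamma> + c * \<tau> n"
        using small[of n]
      proof eventually_elim
        case (elim \<gamma>)
        let ?a = "u (apply_bcontfun \<gamma> 0)" and ?b = "u (apply_bcontfun \<gamma> (\<tau> n))"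
        have "(?b - ?a)\<^sup>2 \<le> (L * R * \<tau> n)\<^sup>2"
          using power_mono[OF elim, of 2] by simp
        then have "?b\<^sup>2 - ?a\<^sup>2 \<le> 2 * \<bar>?a\<bar> * \<bar>?b - ?a\<bar> + (L * R * \<tau> n)\<^sup>2"
          using square_diff_le[of ?b ?a] by linarith
        also have "\<dots> = (f n \<gamma> + c * \<tau> n) * \<tau> n"
          using \<tau>[of n] by (simp add: f_def c_def power2_eq_square field_simps)
        finally show ?case using \<tau>[of n] by (simp add: pos_divide_le_eq)
      qed
    qed (use sq_int f_int in auto)
    also have "\<dots> = (LINT \<gamma>|\<nu>. f n \<gamma>) + c * \<tau> n"
      using f_int by (simp add: prob_space)
    finally have "J * N - c * \<tau> n \<le> (LINT \<gamma>|\<nu>. f n \<gamma>)" by simp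
    then have "ennreal (J * N - c * \<tau> n) \<le> ennreal (LINT \<gamma>|\<nu>. f n \<gamma>)" by (rule ennreal_leI)
    also have "\<dots> = (\<integral>\<^sup>+ \<gamma>. ennreal (f n \<gamma>) \<partial>\<nu>)"
      using f_int f0 by (intro nn_integral_eq_integral[symmetric]) auto
    finally show ?thesis .
  qed
  define X where "X = (\<integral>\<^sup>+ x. ennreal (2 * \<bar>u x\<bar> * dist x0 x) * local_lip u x \<partial>m)"
  have "(\<lambda>n. ennreal (J * N - c * \<tau> n)) \<longlonglongrightarrow> ennreal (J * N - c * 0)"
    by (intro tendsto_intros \<tau>_lim)
  then have "ennreal (J * N) = limsup (\<lambda>n. ennreal (J * N - c * \<tau> n))"
    by (simp add: lim_imp_Limsup)
  also have "\<dots> \<le> limsup (\<lambda>n. \<integral>\<^sup>+ \<gamma>. ennreal (f n \<gamma>) \<partial>\<nu>)"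
    using main by (intro Limsup_mono) simp
  also have "\<dots> \<le> (\<integral>\<^sup>+ \<gamma>. limsup (\<lambda>n. ennreal (f n \<gamma>)) \<partial>\<nu>)"
  proof (rule nn_integral_limsup)
    show "AE \<gamma> in \<nu>. ennreal (f n \<gamma>) \<le> ennreal W" for n
      using fW[of n] by eventually_elim (rule ennreal_leI)
    show "(\<integral>\<^sup>+ \<gamma>. ennreal W \<partial>\<nu>) < \<infinity>" using emeasure_space_1 by simp
  qed measurable
  also have "\<dots> \<le> (\<integral>\<^sup>+ \<gamma>. (\<lambda>x. ennreal (2 * \<bar>u x\<bar> * dist x0 x) * local_lip u x) (apply_bcontfun \<gamma> 0) \<partial>\<nu>)"
  proof (rule nn_integral_mono_AE)
    show "AE \<gamma> in \<nu>. limsup (\<lambda>n. ennreal (f n \<gamma>))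
      \<le> (\<lambda>x. ennreal (2 * \<bar>u x\<bar> * dist x0 x) * local_lip u x) (apply_bcontfun \<gamma> 0)"
      using geo
    proof eventually_elim
      case (elim \<gamma>)
      then show ?case
        using limsup_along_geodesic[of \<gamma> \<tau> "2 * \<bar>u (apply_bcontfun \<gamma> 0)\<bar>" u] \<tau> \<tau>_lim
        by (simp add: f_def dist_commute)
    qed
  qed
  also have "\<dots> = (\<integral>\<^sup>+ x. ennreal (2 * \<bar>u x\<bar> * dist x0 x) * local_lip u x \<partial>distr \<nu> borel (\<lambda>\<gamma>. apply_bcontfun \<gamma> 0))"
    by (subst nn_integral_distr) auto
  also have "distr \<nu> borel (\<lambda>\<gamma>. apply_bcontfun \<gamma> 0) = uniform_measure m (ball x0 R)"
    using plan by (simp add: contraction_plan_def)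
  also have "(\<integral>\<^sup>+ x. ennreal (2 * \<bar>u x\<bar> * dist x0 x) * local_lip u x \<partial>uniform_measure m (ball x0 R))
    = (\<integral>\<^sup>+ x. ennreal (2 * \<bar>u x\<bar> * dist x0 x) * local_lip u x * indicator (ball x0 R) x \<partial>m) / emeasure m (ball x0 R)"
    by (rule nn_integral_uniform_measure) (auto simp: s)
  also have "\<dots> \<le> X / emeasure m (ball x0 R)"
    unfolding X_def by (intro divide_right_mono_ennreal nn_integral_mono) (auto simp: indicator_def)
  finally have "ennreal (J * N) * ennreal mu \<le> X / ennreal mu * ennreal mu"
    unfolding mu by (rule mult_right_mono) simp
  also have "\<dots> = X"
    using mu(1) by (simp add: ennreal_divide_times ennreal_divide_self)
  finally show ?thesis
    unfolding X_def[symmetric] I_def[symmetric] I_eq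
    using J0 N mu(1) by (simp add: ennreal_mult mult_ac)
qed

text \<open>
The Cauchy-Schwarz inequality applied to the right-hand side of the divergence estimate.
\<close>

lemma volume_cone_uncertainty:
  fixes m :: "'a::polish_space measure"
  assumes m: "metric_measure_space m" and mcp: "MCP0 N m" and N: "0 \<le> N"
    and cone: "volume_cone_at N m x0"
  shows "uncertainty_inequality m x0 (N\<^sup>2 / 4)"
  unfolding uncertainty_inequality_def
proof
  fix u :: "'a \<Rightarrow> real" assume "u \<in> Lip_c"
  then obtain L where lip: "L-lipschitz_on UNIV u" and "compact (closure {x. u x \<noteq> 0})"
    by (auto simp: Lip_c_def)
  then have "bounded {x. u x \<noteq> 0}"
    by (meson bounded_subset closure_subset compact_imp_bounded)
  then obtain \<rho> where \<rho>: "0 < \<rho>" "{x. u x \<noteq> 0} \<subseteq> ball x0 \<rho>"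
    using bounded_subset_ballD by blast
  note s[measurable_cong] = mms_sets[OF m]
  have cont: "continuous_on UNIV u" by (rule lipschitz_on_continuous_on[OF lip])
  have [measurable]: "u \<in> borel_measurable borel" by (rule borel_measurable_continuous_onI[OF cont])
  have [measurable]: "local_lip u \<in> borel_measurable borel" by (rule measurable_local_lip[OF cont])
  define I where "I = (\<integral>\<^sup>+ x. ennreal ((u x)\<^sup>2) \<partial>m)"
  define A where "A = (\<integral>\<^sup>+ x. (local_lip u x)\<^sup>2 \<partial>m)"
  define B where "B = (\<integral>\<^sup>+ x. ennreal ((dist x0 x)\<^sup>2 * (u x)\<^sup>2) \<partial>m)"
  have "ennreal N * I \<le> (\<integral>\<^sup>+ x. ennreal (2 * \<bar>u x\<bar> * dist x0 x) * local_lip u x \<partial>m)"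
    unfolding I_def using \<rho> by (intro volume_cone_divergence[OF m mcp N cone lip]) auto
  also have "\<dots> = 2 * (\<integral>\<^sup>+ x. ennreal (dist x0 x * \<bar>u x\<bar>) * local_lip u x \<partial>m)"
    by (subst nn_integral_cmult[symmetric])
      (auto simp: ennreal_mult mult_ac intro!: nn_integral_cong)
  finally have "(ennreal N * I)\<^sup>2 \<le> (2 * (\<integral>\<^sup>+ x. ennreal (dist x0 x * \<bar>u x\<bar>) * local_lip u x \<partial>m))\<^sup>2"
    by (rule power_mono) simp
  also have "\<dots> = 4 * (\<integral>\<^sup>+ x. ennreal (dist x0 x * \<bar>u x\<bar>) * local_lip u x \<partial>m)\<^sup>2"
    by (simp add: power_mult_distrib)
  also have "\<dots> \<le> 4 * ((\<integral>\<^sup>+ x. (ennreal (dist x0 x * \<bar>u x\<bar>))\<^sup>2 \<partial>m) * A)"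
    unfolding A_def by (intro mult_left_mono Cauchy_Schwarz_nn_integral) auto
  also have "(\<integral>\<^sup>+ x. (ennreal (dist x0 x * \<bar>u x\<bar>))\<^sup>2 \<partial>m) = B"
    unfolding B_def by (simp add: ennreal_power power_mult_distrib)
  finally have "ennreal (1 / 4) * (ennreal N * I)\<^sup>2 \<le> ennreal (1 / 4) * (4 * (B * A))"
    by (rule mult_left_mono) simp
  also have "\<dots> = A * B"
  proof -
    have "ennreal (1 / 4) * ennreal 4 = ennreal (1 / 4 * 4)" by (rule ennreal_mult[symmetric]) auto
    then have "ennreal (1 / 4) * 4 = 1" by simp
    have "ennreal (1 / 4) * (4 * (B * A)) = ennreal (1 / 4) * 4 * (B * A)"
      by (simp only: mult.assoc)
    then show ?thesis
      unfolding \<open>ennreal (1 / 4) * 4 = 1\<close> by (simp add: mult.commute)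
  qed
  also have "ennreal (1 / 4) * (ennreal N * I)\<^sup>2 = ennreal (N\<^sup>2 / 4) * I\<^sup>2"
  proof -
    have "ennreal (N\<^sup>2 / 4) = ennreal (1 / 4 * N\<^sup>2)" by simp
    also have "\<dots> = ennreal (1 / 4) * ennreal (N\<^sup>2)" by (rule ennreal_mult) auto
    also have "ennreal (N\<^sup>2) = (ennreal N)\<^sup>2" by (rule ennreal_power[OF N, symmetric])
    finally show ?thesis by (simp only: power_mult_distrib mult.assoc)
  qed
  finally show "ennreal (N\<^sup>2 / 4) * (\<integral>\<^sup>+ x. ennreal ((u x)\<^sup>2) \<partial>m)\<^sup>2
    \<le> (\<integral>\<^sup>+ x. (local_lip u x)\<^sup>2 \<partial>m) * (\<integral>\<^sup>+ x. ennreal ((dist x0 x)\<^sup>2 * (u x)\<^sup>2) \<partial>m)"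
    unfolding I_def A_def B_def .
qed

theorem theorem1p1:
  fixes N :: real and m :: "'a::polish_space measure"
  assumes "1 < N"
    and "metric_measure_space m"
    and "geodesic_space TYPE('a)"
    and "essentially_nonbranching m"
    and "MCP0 N m"
  shows "(\<exists>x0. uncertainty_inequality m x0 (N\<^sup>2 / 4) \<and>
               (\<forall>C > N\<^sup>2 / 4. \<not> uncertainty_inequality m x0 C))
         \<longleftrightarrow> volume_cone N m"
proof -
  have N: "0 \<le> N" using assms(1) by simp
  note cone = volume_cone_of_uncertainty[OF assms(2,5) N]
    and ineq = volume_cone_uncertainty[OF assms(2,5) N]
    and sharp = uncertainty_constant_le[OF assms(2,5) N]
  show ?thesis
    unfolding volume_cone_iff using cone ineq sharp by (blast dest: leD)
qed

end
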